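(* Let $d>1$. Then the proper edge $2d$-coloring problem $\Pi^d_{\chi',2d}$ is in the class $\mathsf{BOREL}$. In particular, if $\mathbb{Z}^d$ acts freely and in a Borel way on a standard Borel space and $\mathcal G$ is the Borel graph generated by the standard generators of $\mathbb{Z}^d$, then $\chi'_{\mathcal B}(\mathcal G)=2d$, i.e., the Borel edge chromatic number of $\mathcal G$ is equal to $2d$.
   Context: A free Borel action of $\mathbb{Z}^d$ on a standard Borel space $X$ is given by pairwise commuting Borel bijections $\varphi_1,\dots,\varphi_d:X\to X$ (the actions of the standard generators) such that no nonzero element of $\mathbb{Z}^d$ fixes a point of $X$ ($X$ nonempty). The Borel graph $\mathcal G$ generated by it has vertex set $X$ and edges $(x,\varphi_i(x))$, $x\in X$, $1\le i\le d$ (each edge labelled by its generator); each connected component is a copy of the grid $\mathbb{Z}^d$. The proper edge $2d$-coloring problem $\Pi^d_{\chi',2d}$ asks for a coloring of the edges with $2d$ colors so that any two edges sharing a vertex have different colors; it is regarded as a vertex labelling problem by letting each vertex output the colors of its incident edges consistently. A locally checkable problem (without inputs) is in the class $\mathsf{BOREL}$ if, for every free Borel action of $\mathbb{Z}^d$ on a standard Borel space $X$, given by Borel bijections $\varphi_1,\dots,\varphi_d$, the Borel graph $\mathcal G$ with vertex set $X$ and edges $(x,\varphi_i(x))$, $x\in X$, $1\le i\le d$ (each labelled by its generator), admits a Borel measurable solution. The Borel edge chromatic number $\chi'_{\mathcal B}(\mathcal G)$ is the least number of colors in a Borel measurable proper edge coloring of $\mathcal G$. *)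

theory Defs
  imports "HOL-Analysis.Analysis" "HOL-Library.Extended_Nat"
begin

definition polish_topology :: "'a topology \<Rightarrow> bool" where
  "polish_topology T \<longleftrightarrow> completely_metrizable_space T \<and> separable_space T"

text \<open>A standard Borel space is given as a measure, of which only the underlying set and
  the sigma-algebra matter.\<close>

definition standard_borel :: "'a measure \<Rightarrow> bool" where
  "standard_borel M \<longleftrightarrow>
     (\<exists>T. polish_topology T \<and> topspace T = space M \<and>
          sets M = sigma_sets (space M) {U. openin T U})"


section \<open>Free Borel actions of the integer lattice\<close>

text \<open>Elements of the group are integer sequences that vanish from position \<open>d\<close> on; the
  coordinates are numbered \<open>0, \<dots>, d - 1\<close>.\<close>

definition lattice :: "nat \<Rightarrow> (nat \<Rightarrow> int) set" where
  "lattice d = {z. \<forall>i\<ge>d. z i = 0}"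

definition axis_vec :: "nat \<Rightarrow> int \<Rightarrow> nat \<Rightarrow> int" where
  "axis_vec i k = (\<lambda>j. if j = i then k else 0)"

definition int_iterate :: "'a set \<Rightarrow> ('a \<Rightarrow> 'a) \<Rightarrow> int \<Rightarrow> 'a \<Rightarrow> 'a" where
  "int_iterate X f k = (if 0 \<le> k then f ^^ nat k else inv_into X f ^^ nat (- k))"

primrec lattice_act :: "'a set \<Rightarrow> (nat \<Rightarrow> 'a \<Rightarrow> 'a) \<Rightarrow> nat \<Rightarrow> (nat \<Rightarrow> int) \<Rightarrow> 'a \<Rightarrow> 'a" where
  "lattice_act X \<phi> 0 z x = x"
| "lattice_act X \<phi> (Suc n) z x = int_iterate X (\<phi> n) (z n) (lattice_act X \<phi> n z x)"

text \<open>Measurability of the inverses of the generators is not demanded: for bijections of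
  standard Borel spaces it follows from the Lusin--Souslin theorem.\<close>

definition free_borel_action :: "nat \<Rightarrow> 'a measure \<Rightarrow> (nat \<Rightarrow> 'a \<Rightarrow> 'a) \<Rightarrow> bool" where
  "free_borel_action d M \<phi> \<longleftrightarrow>
     standard_borel M \<and> space M \<noteq> {} \<and>
     (\<forall>i<d. \<phi> i \<in> measurable M M \<and> bij_betw (\<phi> i) (space M) (space M)) \<and>
     (\<forall>i<d. \<forall>j<d. \<forall>x\<in>space M. \<phi> i (\<phi> j x) = \<phi> j (\<phi> i x)) \<and>
     (\<forall>z\<in>lattice d. z \<noteq> (\<lambda>_. 0) \<longrightarrow>
        (\<forall>x\<in>space M. lattice_act (space M) \<phi> d z x \<noteq> x))"


section \<open>Locally checkable problems on labelled grids\<close>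

text \<open>A problem without inputs consists of a set of vertex labels, a locality radius \<open>t\<close> and
  the collection of allowed labellings of the radius \<open>t\<close> neighbourhood of a vertex. As the
  edges of the grid are labelled by the generators, this neighbourhood is identified with
  the ball of radius \<open>t\<close> around the origin in the word metric. Labellings are extensional
  functions on that ball.\<close>

record 'l problem =
  out_labels :: "'l set"
  radius :: nat
  allowed :: "((nat \<Rightarrow> int) \<Rightarrow> 'l) set"

definition lattice_ball :: "nat \<Rightarrow> nat \<Rightarrow> (nat \<Rightarrow> int) set" where
  "lattice_ball d t = {z \<in> lattice d. (\<Sum>i<d. \<bar>z i\<bar>) \<le> int t}"

definition locally_checkable :: "nat \<Rightarrow> 'l problem \<Rightarrow> bool" where
  "locally_checkable d P \<longleftrightarrow>
     finite (out_labels P) \<and>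
     allowed P \<subseteq> (lattice_ball d (radius P) \<rightarrow>\<^sub>E out_labels P)"

definition borel_solution ::
    "nat \<Rightarrow> 'l problem \<Rightarrow> 'a measure \<Rightarrow> (nat \<Rightarrow> 'a \<Rightarrow> 'a) \<Rightarrow> ('a \<Rightarrow> 'l) \<Rightarrow> bool" where
  "borel_solution d P M \<phi> f \<longleftrightarrow>
     f \<in> measurable M (count_space (out_labels P)) \<and>
     (\<forall>x\<in>space M.
        (\<lambda>z\<in>lattice_ball d (radius P). f (lattice_act (space M) \<phi> d z x)) \<in> allowed P)"

text \<open>HOL cannot quantify over types inside a formula, so the class depends on the type that
  carries the standard Borel spaces. Membership for every type is expressed by leaving
  \<open>'a\<close> free in a theorem.\<close>

definition in_BOREL :: "'a itself \<Rightarrow> nat \<Rightarrow> 'l problem \<Rightarrow> bool" where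
  "in_BOREL _ d P \<longleftrightarrow>
     locally_checkable d P \<and>
     (\<forall>(M :: 'a measure) \<phi>. free_borel_action d M \<phi> \<longrightarrow> (\<exists>f. borel_solution d P M \<phi> f))"

text \<open>The half-edge \<open>(i, True)\<close> at \<open>x\<close> belongs to the edge from \<open>x\<close> to \<open>\<phi> i x\<close>, and
  \<open>(i, False)\<close> to the edge arriving at \<open>x\<close> from its predecessor under \<open>\<phi> i\<close>. The label of a
  vertex records the colours of all its half-edges.\<close>

definition half_edges :: "nat \<Rightarrow> (nat \<times> bool) set" where
  "half_edges d = {..<d} \<times> UNIV"

definition edge_coloring_problem :: "nat \<Rightarrow> nat \<Rightarrow> (nat \<times> bool \<Rightarrow> nat) problem" where
  "edge_coloring_problem d k =
     \<lparr> out_labels = half_edges d \<rightarrow>\<^sub>E {..<k},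
       radius = 1,
       allowed = {l \<in> lattice_ball d 1 \<rightarrow>\<^sub>E (half_edges d \<rightarrow>\<^sub>E {..<k}).
         inj_on (l (\<lambda>_. 0)) (half_edges d) \<and>
         (\<forall>i<d. l (\<lambda>_. 0) (i, True) = l (axis_vec i 1) (i, False) \<and>
                l (\<lambda>_. 0) (i, False) = l (axis_vec i (- 1)) (i, True))} \<rparr>"


section \<open>Borel edge chromatic number\<close>

text \<open>A graph is given by its symmetric adjacency relation, and an edge colouring is a
  function on adjacent ordered pairs that is invariant under swapping the endpoints.\<close>

definition generated_graph :: "nat \<Rightarrow> 'a measure \<Rightarrow> (nat \<Rightarrow> 'a \<Rightarrow> 'a) \<Rightarrow> ('a \<times> 'a) set" where
  "generated_graph d M \<phi> =
     {(x, y). x \<in> space M \<and> y \<in> space M \<and> (\<exists>i<d. y = \<phi> i x \<or> x = \<phi> i y)}"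

definition borel_edge_coloring ::
    "'a measure \<Rightarrow> ('a \<times> 'a) set \<Rightarrow> nat \<Rightarrow> ('a \<times> 'a \<Rightarrow> nat) \<Rightarrow> bool" where
  "borel_edge_coloring M E k c \<longleftrightarrow>
     c \<in> measurable (restrict_space (M \<Otimes>\<^sub>M M) E) (count_space {..<k}) \<and>
     (\<forall>x y. (x, y) \<in> E \<longrightarrow> c (x, y) = c (y, x)) \<and>
     (\<forall>x y z. (x, y) \<in> E \<and> (x, z) \<in> E \<and> y \<noteq> z \<longrightarrow> c (x, y) \<noteq> c (x, z))"

text \<open>All infinite values are identified with \<open>\<infinity>\<close>, the infimum of the empty set.\<close>

definition borel_edge_chromatic_number :: "'a measure \<Rightarrow> ('a \<times> 'a) set \<Rightarrow> enat" where
  "borel_edge_chromatic_number M E = Inf {enat k | k. \<exists>c. borel_edge_coloring M E k c}"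

end

theory Submission
  imports Defs "HOL-Library.Function_Algebras"
begin

text \<open>Colour the edges of direction \<open>i\<close> alternately with two colours of their own. This needs a
  parity along each line, which can be chosen on regions with finite components but not
  globally, so the parities jump across the walls between regions. For \<open>d > 1\<close> a jump can be
  absorbed: on two neighbouring lines of direction \<open>i\<close>, joined by rungs of one colour \<open>c\<close> in
  another direction, colour the two parallel edges at the jump with \<open>c\<close> and give each rung
  next to them the colour that is now missing at both of its ends. It remains to find
  Borel walls, one family for each direction, that are far apart from each other and
  leave only finite components. They are taken to be level sets of the distance to a
  Borel set \<open>B\<close> such that \<open>B\<close> and its complement have finite components even when points
  at a large bounded distance count as adjacent. Such a set is assembled from balls around
  markers of rapidly increasing scales. The inverses of the generators are measurable
  by Lusin separation.\<close>

section \<open>Lusin separation and measurability of inverses\<close>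

text \<open>A parity along direction \<open>i\<close> on the whole space would be a Borel set that
  \<open>\<phi> i\<close> exchanges with its complement. It would be invariant under the square of
  \<open>\<phi> i\<close>, which is impossible if that square is ergodic for a probability measure
  preserved by \<open>\<phi> i\<close>. So jumps are forced.

  The repair only rearranges colours: at every vertex it touches, the edges of directions
  \<open>i\<close> and \<open>rung i\<close> together still carry the four colours of these two
  directions. Hence it is enough that all \<open>2 * d\<close> colours occur at each vertex; that
  they are distinct follows by counting. For the rearrangement to work, defects must come in pairs
  joined by a rung, defects of one line must not be adjacent, and repairs of different directions
  must not meet. Rounding the walls to two by two blocks gives the first two properties. The third
  comes from placing the walls at levels \<open>20 * i\<close> of one function that changes by at
  most 1 along edges. The parities of the two sides of a wall are chosen on overlapping regions, so
  the wall can be moved by a bounded amount.\<close>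

definition complete_covers :: "'a topology \<Rightarrow> 'a set \<Rightarrow> (nat \<Rightarrow> nat \<Rightarrow> 'a set) \<Rightarrow> bool" where
  "complete_covers Z B C \<longleftrightarrow>
     (\<forall>i. B \<subseteq> (\<Union>k. C i k)) \<and>
     (\<forall>\<alpha>. (\<forall>n. B \<inter> (\<Inter>i<n. C i (\<alpha> i)) \<noteq> {}) \<longrightarrow>
        (\<exists>x\<in>B. \<forall>U. openin Z U \<and> x \<in> U \<longrightarrow> (\<exists>n. B \<inter> (\<Inter>i<n. C i (\<alpha> i)) \<subseteq> U)))"

lemma complete_coversI:
  assumes "\<And>i x. x \<in> B \<Longrightarrow> \<exists>k. x \<in> C i k"
    and "\<And>\<alpha>. (\<And>n. B \<inter> (\<Inter>i<n. C i (\<alpha> i)) \<noteq> {}) \<Longrightarrow>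
        (\<exists>x\<in>B. \<forall>U. openin Z U \<and> x \<in> U \<longrightarrow> (\<exists>n. B \<inter> (\<Inter>i<n. C i (\<alpha> i)) \<subseteq> U))"
  shows "complete_covers Z B C"
  unfolding complete_covers_def
proof (intro conjI allI impI)
  show "B \<subseteq> (\<Union>k. C i k)" for i using assms(1) by blast
qed (use assms(2) in simp)

lemma complete_covers_cover:
  "complete_covers Z B C \<Longrightarrow> x \<in> B \<Longrightarrow> \<exists>k. x \<in> C i k"
  unfolding complete_covers_def by blast

lemma complete_covers_limit:
  assumes "complete_covers Z B C" "\<And>n. B \<inter> (\<Inter>i<n. C i (\<alpha> i)) \<noteq> {}"
  shows "\<exists>x\<in>B. \<forall>U. openin Z U \<and> x \<in> U \<longrightarrow> (\<exists>n. B \<inter> (\<Inter>i<n. C i (\<alpha> i)) \<subseteq> U)"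
  using assms(1)[unfolded complete_covers_def, THEN conjunct2, rule_format, of \<alpha>, OF assms(2)] .

text \<open>Complete covers replace a parametrisation of \<open>B\<close> by sequences of naturals:
  every point follows a branch, and every branch with nonempty cells converges to a point of
  \<open>B\<close>. For a closed set, balls of radius \<open>1 / Suc i\<close> around a countable
  dense set serve: cells along a branch shrink, completeness gives a limit, and closedness keeps it
  in \<open>B\<close>.\<close>

lemma closedin_complete_covers:
  assumes "completely_metrizable_space Z" "separable_space Z" "closedin Z B"
  shows "\<exists>C. complete_covers Z B C"
proof (cases "B = {}")
  case True
  then show ?thesis by (intro exI[of _ undefined]) (auto simp: complete_covers_def)
next
  case False
  obtain M d where Md: "Metric_space M d" "Metric_space.mcomplete M d" "Z = Metric_space.mtopology M d"
    using assms(1) unfolding completely_metrizable_space_def by blast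
  interpret Metric_space M d by (rule Md(1))
  have Z: "Z = mtopology" by (rule Md(3))
  obtain Q where Q: "countable Q" "Q \<subseteq> M" "mtopology closure_of Q = M"
    using assms(2) unfolding separable_space_def Z by auto
  have BM: "B \<subseteq> M" using assms(3) Z closedin_subset by fastforce
  have "Q \<noteq> {}" using Q(3) False BM by auto
  then have rq: "range (from_nat_into Q) = Q" using Q(1) by simp
  define q where "q = from_nat_into Q"
  define C where "C i k = mcball (q k) (1 / Suc i)" for i k :: nat
  have "complete_covers Z B C"
  proof (rule complete_coversI)
    fix i x assume "x \<in> B"
    then have "x \<in> mtopology closure_of Q" using BM Q(3) by blast
    then obtain y where "y \<in> Q" "d x y < 1 / Suc i"
      unfolding metric_closure_of by (auto dest!: spec[of _ "1 / Suc i"])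
    then show "\<exists>k. x \<in> C i k" using rq BM \<open>x \<in> B\<close> Q(2)
      unfolding C_def q_def by (force simp: commute)
  next
    fix \<alpha> assume ne: "\<And>n. B \<inter> (\<Inter>i<n. C i (\<alpha> i)) \<noteq> {}"
    let ?E = "\<lambda>n. B \<inter> (\<Inter>i<n. C i (\<alpha> i))"
    have "\<forall>n. \<exists>y. y \<in> ?E n" using ne by blast
    then obtain y where y: "\<And>n. y n \<in> ?E n" by metis
    have close: "d u v \<le> 2 / Suc N" if "u \<in> ?E (Suc N)" "v \<in> ?E (Suc N)" for u v N
    proof -
      have "u \<in> mcball (q (\<alpha> N)) (1 / Suc N)" "v \<in> mcball (q (\<alpha> N)) (1 / Suc N)"
        using that unfolding C_def by auto
      then have "d u v \<le> 1 / Suc N + 1 / Suc N"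
        using triangle[of u "q (\<alpha> N)" v] by (simp add: commute)
      then show ?thesis by simp
    qed
    have mono: "?E n \<subseteq> ?E m" if "m \<le> n" for m n using that by auto
    have "MCauchy y"
      unfolding MCauchy_def
    proof (intro conjI allI impI)
      show "range y \<subseteq> M" using y BM by blast
      fix \<epsilon> :: real assume "\<epsilon> > 0"
      then obtain N :: nat where "2 / \<epsilon> < N" using reals_Archimedean2 by blast
      then have N: "2 / Suc N < \<epsilon>" using \<open>\<epsilon> > 0\<close> by (simp add: field_simps)
      show "\<exists>N. \<forall>n n'. N \<le> n \<longrightarrow> N \<le> n' \<longrightarrow> d (y n) (y n') < \<epsilon>"
      proof (intro exI[of _ "Suc N"] allI impI)
        fix n n' assume "Suc N \<le> n" "Suc N \<le> n'"
        then have "d (y n) (y n') \<le> 2 / Suc N"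
          using mono y by (intro close) blast+
        then show "d (y n) (y n') < \<epsilon>" using N by linarith
      qed
    qed
    then obtain x where x: "limitin mtopology y x sequentially"
      using Md(2) unfolding mcomplete_def by blast
    have xB: "x \<in> B"
      using limitin_closedin[OF x assms(3)[unfolded Z]] y by auto
    show "\<exists>x\<in>B. \<forall>U. openin Z U \<and> x \<in> U \<longrightarrow> (\<exists>n. ?E n \<subseteq> U)"
    proof (intro bexI[OF _ xB] allI impI)
      fix U assume "openin Z U \<and> x \<in> U"
      then obtain \<epsilon> where \<epsilon>: "\<epsilon> > 0" "mball x \<epsilon> \<subseteq> U" unfolding Z openin_mtopology by blast
      \<comment> \<open>The 3 is made of the bound 2 for the diameter of a cell and 1 for the
        distance of a late \<open>y n\<close> from the limit.\<close>
      then obtain N :: nat where "3 / \<epsilon> < N" using reals_Archimedean2 by blast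
      then have N: "3 / Suc N < \<epsilon>" using \<open>\<epsilon> > 0\<close> by (simp add: field_simps)
      have "eventually (\<lambda>n. y n \<in> M \<and> d (y n) x < 1 / Suc N) sequentially"
        using x unfolding limitin_metric by auto
      then obtain K where K: "\<And>n. n \<ge> K \<Longrightarrow> d (y n) x < 1 / Suc N"
        unfolding eventually_sequentially by blast
      have "?E (Suc N) \<subseteq> mball x \<epsilon>"
      proof
        fix z assume z: "z \<in> ?E (Suc N)"
        let ?n = "max K (Suc N)"
        have "y ?n \<in> ?E (Suc N)" using y[of ?n] mono[of "Suc N" ?n] by auto
        then have "d z (y ?n) \<le> 2 / Suc N" using close z by blast
        moreover have "d (y ?n) x < 1 / Suc N" using K by simp
        moreover have "d z x \<le> d z (y ?n) + d (y ?n) x"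
          using z y xB BM by (intro triangle) blast+
        moreover have "2 / real (Suc N) + 1 / Suc N = 3 / Suc N" by (simp add: field_simps)
        ultimately have "d z x < \<epsilon>" using N by linarith
        then show "z \<in> mball x \<epsilon>" using z xB BM by (auto simp: commute)
      qed
      then show "\<exists>n. ?E n \<subseteq> U" using \<epsilon> by blast
    qed
  qed
  then show ?thesis by blast
qed

text \<open>The first entry of a branch selects the set in which the limit is sought, and the
  remaining entries are a branch for that set. Sending each point to its least index makes the first
  cover a partition, so the selection is unambiguous.\<close>

lemma UN_complete_covers:
  fixes B :: "nat \<Rightarrow> 'a set"
  assumes "\<And>m. \<exists>C. complete_covers Z (B m) C"
  shows "\<exists>C. complete_covers Z (\<Union>m. B m) C"
proof -
  obtain C where C: "\<And>m. complete_covers Z (B m) (C m)" using assms by metis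
  define l where "l x = (LEAST m. x \<in> B m)" for x
  have l: "x \<in> B (l x)" if "x \<in> B m" for x m
    unfolding l_def using that by (rule LeastI)
  define D where "D i k = (case i of 0 \<Rightarrow> {x \<in> \<Union>m. B m. l x = k}
      | Suc j \<Rightarrow> {x \<in> \<Union>m. B m. x \<in> C (l x) j k})" for i k :: nat
  have "complete_covers Z (\<Union>m. B m) D"
  proof (rule complete_coversI)
    fix i x assume x: "x \<in> (\<Union>m. B m)"
    then have xl: "x \<in> B (l x)" using l[of x] by auto
    show "\<exists>k. x \<in> D i k"
    proof (cases i)
      case (Suc j)
      then show ?thesis using complete_covers_cover[OF C xl, of j] x by (auto simp: D_def)
    qed (use x in \<open>auto simp: D_def\<close>)
  next
    fix \<alpha> assume ne: "\<And>n. (\<Union>m. B m) \<inter> (\<Inter>i<n. D i (\<alpha> i)) \<noteq> {}"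
    let ?m = "\<alpha> 0"
    have sub: "(\<Union>m. B m) \<inter> (\<Inter>i<Suc n. D i (\<alpha> i)) \<subseteq> B ?m \<inter> (\<Inter>i<n. C ?m i (\<alpha> (Suc i)))" for n
    proof
      fix x assume x: "x \<in> (\<Union>m. B m) \<inter> (\<Inter>i<Suc n. D i (\<alpha> i))"
      then have "x \<in> D 0 (\<alpha> 0)" by blast
      then have lx: "l x = ?m" by (simp add: D_def)
      have "x \<in> C ?m i (\<alpha> (Suc i))" if "i < n" for i
      proof -
        have "x \<in> D (Suc i) (\<alpha> (Suc i))" using x that by blast
        then show ?thesis using lx by (simp add: D_def)
      qed
      moreover have "x \<in> B ?m" using x l[of x] lx by auto
      ultimately show "x \<in> B ?m \<inter> (\<Inter>i<n. C ?m i (\<alpha> (Suc i)))" by blast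
    qed
    have ne1: "B ?m \<inter> (\<Inter>i<n. C ?m i (\<alpha> (Suc i))) \<noteq> {}" for n using sub[of n] ne[of "Suc n"] by blast
    obtain x where x: "x \<in> B ?m" "\<forall>U. openin Z U \<and> x \<in> U \<longrightarrow>
        (\<exists>n. B ?m \<inter> (\<Inter>i<n. C ?m i (\<alpha> (Suc i))) \<subseteq> U)"
      using complete_covers_limit[OF C[of ?m], of "\<lambda>i. \<alpha> (Suc i)", OF ne1]
      by (rule bexE)
    show "\<exists>x\<in>\<Union>m. B m. \<forall>U. openin Z U \<and> x \<in> U \<longrightarrow> (\<exists>n. (\<Union>m. B m) \<inter> (\<Inter>i<n. D i (\<alpha> i)) \<subseteq> U)"
    proof (intro bexI[of _ x] allI impI)
      fix U assume "openin Z U \<and> x \<in> U"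
      then have "\<exists>n. B ?m \<inter> (\<Inter>i<n. C ?m i (\<alpha> (Suc i))) \<subseteq> U" by (intro x(2)[rule_format])
      then obtain n where "B ?m \<inter> (\<Inter>i<n. C ?m i (\<alpha> (Suc i))) \<subseteq> U" by (elim exE)
      then show "\<exists>n. (\<Union>m. B m) \<inter> (\<Inter>i<n. D i (\<alpha> i)) \<subseteq> U"
        by (intro exI[of _ "Suc n"] subset_trans[OF sub])
    next
      show "x \<in> (\<Union>m. B m)" using x(1) by blast
    qed
  qed
  then show ?thesis by blast
qed

text \<open>A branch for the intersection interleaves one branch for each \<open>B m\<close>. The
  limits obtained, one in each \<open>B m\<close>, all have neighbourhoods containing late cells of
  the same decreasing sequence. These cells are nonempty, so the Hausdorff property forces the
  limits to coincide.\<close>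

lemma INT_complete_covers:
  fixes B :: "nat \<Rightarrow> 'a set"
  assumes "Hausdorff_space Z" "\<And>m. B m \<subseteq> topspace Z" "\<And>m. \<exists>C. complete_covers Z (B m) C"
  shows "\<exists>C. complete_covers Z (\<Inter>m. B m) C"
proof -
  obtain C where C: "\<And>m. complete_covers Z (B m) (C m)" using assms(3) by metis
  define D where "D i k = C (fst (prod_decode i)) (snd (prod_decode i)) k" for i k
  have "complete_covers Z (\<Inter>m. B m) D"
  proof (rule complete_coversI)
    fix i x assume x: "x \<in> (\<Inter>m. B m)"
    show "\<exists>k. x \<in> D i k" unfolding D_def
      by (rule complete_covers_cover[OF C]) (use x in blast)
  next
    fix \<alpha> assume ne: "\<And>n. (\<Inter>m. B m) \<inter> (\<Inter>i<n. D i (\<alpha> i)) \<noteq> {}"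
    let ?E = "\<lambda>n. (\<Inter>m. B m) \<inter> (\<Inter>i<n. D i (\<alpha> i))"
    let ?F = "\<lambda>m n. B m \<inter> (\<Inter>i<n. C m i (\<alpha> (prod_encode (m, i))))"
    have mono: "?E n \<subseteq> ?E m" if "m \<le> n" for m n using that by auto
    \<comment> \<open>The first \<open>n\<close> entries of the branch for \<open>B m\<close> occur
      among finitely many entries of the interleaved branch.\<close>
    have sub: "\<exists>N. ?E N \<subseteq> ?F m n" for m n
    proof (induction n)
      case (Suc n)
      then obtain N where N: "?E N \<subseteq> ?F m n" by blast
      let ?N = "max N (Suc (prod_encode (m, n)))"
      have "?E ?N \<subseteq> ?F m n" using N mono[of N ?N] by auto
      moreover have "?E ?N \<subseteq> D (prod_encode (m, n)) (\<alpha> (prod_encode (m, n)))" by auto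
      moreover have "D (prod_encode (m, n)) (\<alpha> (prod_encode (m, n))) = C m n (\<alpha> (prod_encode (m, n)))"
        by (simp add: D_def)
      ultimately have "?E ?N \<subseteq> ?F m (Suc n)"
        by (simp only: lessThan_Suc INT_insert Int_subset_iff simp_thms)
      then show ?case by blast
    qed auto
    have lim: "\<exists>x\<in>B m. \<forall>U. openin Z U \<and> x \<in> U \<longrightarrow> (\<exists>n. ?E n \<subseteq> U)" for m
    proof -
      have ne2: "?F m n \<noteq> {}" for n
      proof
        assume "?F m n = {}"
        then obtain N where "?E N \<subseteq> {}" using sub[of m n] by (elim exE) (simp only:)
        then show False using ne[of N] by (simp only: subset_empty simp_thms)
      qed
      obtain x where x: "x \<in> B m" "\<forall>U. openin Z U \<and> x \<in> U \<longrightarrow> (\<exists>n. ?F m n \<subseteq> U)"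
        using complete_covers_limit[OF C[of m], of "\<lambda>i. \<alpha> (prod_encode (m, i))", OF ne2]
        by (rule bexE)
      show ?thesis
      proof (intro bexI[OF _ x(1)] allI impI)
        fix U assume "openin Z U \<and> x \<in> U"
        then have "\<exists>n. ?F m n \<subseteq> U" by (intro x(2)[rule_format])
        then obtain n where "?F m n \<subseteq> U" by (elim exE)
        then show "\<exists>n. ?E n \<subseteq> U" using sub[of m n] by (elim exE) (rule exI, erule (1) subset_trans)
      qed
    qed
    have "\<forall>m. \<exists>x. x \<in> B m \<and> (\<forall>U. openin Z U \<and> x \<in> U \<longrightarrow> (\<exists>n. ?E n \<subseteq> U))"
      by (rule allI) (rule lim[unfolded Bex_def])
    then obtain x where x0: "\<forall>m. x m \<in> B m \<and> (\<forall>U. openin Z U \<and> x m \<in> U \<longrightarrow> (\<exists>n. ?E n \<subseteq> U))"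
      by (rule choice[THEN exE])
    have x: "x m \<in> B m" "openin Z U \<Longrightarrow> x m \<in> U \<Longrightarrow> \<exists>n. ?E n \<subseteq> U" for m U
      using x0 by simp_all
    have eq: "x m = x 0" for m
    proof (rule ccontr)
      assume "x m \<noteq> x 0"
      then obtain U V where UV: "openin Z U" "openin Z V" "x m \<in> U" "x 0 \<in> V" "disjnt U V"
        using assms(1,2) x(1) unfolding Hausdorff_space_def by (meson in_mono)
      obtain n where n0: "?E n \<subseteq> U" using x(2)[OF UV(1,3)] by (elim exE)
      obtain n' where n1: "?E n' \<subseteq> V" using x(2)[OF UV(2,4)] by (elim exE)
      note n = n0 n1
      have "?E (max n n') \<subseteq> U \<inter> V" using n mono[of n "max n n'"] mono[of n' "max n n'"] by auto
      then show False using ne[of "max n n'"] UV(5) unfolding disjnt_def by blast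
    qed
    show "\<exists>x\<in>\<Inter>m. B m. \<forall>U. openin Z U \<and> x \<in> U \<longrightarrow> (\<exists>n. ?E n \<subseteq> U)"
    proof (intro bexI[of _ "x 0"] allI impI)
      show "x 0 \<in> (\<Inter>m. B m)" by (rule INT_I) (metis eq x(1))
    qed (use x(2)[of _ 0] in simp)
  qed
  then show ?thesis by blast
qed

text \<open>The property passes to countable unions and intersections, but not visibly to
  complements, so the induction carries the complement along. It starts from open sets, which are
  countable unions of closed sets in a metrizable space.\<close>

lemma borel_complete_covers:
  assumes Z: "polish_topology Z" and B: "B \<in> sigma_sets (topspace Z) {U. openin Z U}"
  shows "\<exists>C. complete_covers Z B C"
proof -
  have cm: "completely_metrizable_space Z" and sep: "separable_space Z"
    using Z by (auto simp: polish_topology_def)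
  have met: "metrizable_space Z" using cm completely_metrizable_imp_metrizable_space by blast
  have Haus: "Hausdorff_space Z" using met metrizable_imp_Hausdorff_space by blast
  have "(\<exists>C. complete_covers Z B C) \<and> (\<exists>C. complete_covers Z (topspace Z - B) C) \<and> B \<subseteq> topspace Z"
    using B
  proof (induction rule: sigma_sets.induct)
    case (Basic U)
    then have U: "openin Z U" by simp
    then obtain F where F: "\<And>n :: nat. closedin Z (F n)" "(\<Union>n. F n) = U"
      using open_imp_fsigma_in[OF met U] unfolding fsigma_in_ascending by auto
    have "\<exists>C. complete_covers Z (\<Union>n. F n) C"
      by (intro UN_complete_covers closedin_complete_covers cm sep F)
    moreover have "\<exists>C. complete_covers Z (topspace Z - U) C"
      using U by (intro closedin_complete_covers cm sep) auto
    ultimately show ?case using F(2) openin_subset[OF U] by auto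
  next
    case Empty
    have "\<exists>C. complete_covers Z {} C" "\<exists>C. complete_covers Z (topspace Z) C"
      by (intro closedin_complete_covers cm sep; simp)+
    then show ?case by simp
  next
    case (Compl a)
    then show ?case by (simp add: double_diff)
  next
    case (Union a)
    have "topspace Z - (\<Union>i. a i) = (\<Inter>i. topspace Z - a i)" by auto
    moreover have "\<exists>C. complete_covers Z (\<Inter>i. topspace Z - a i) C"
      using Union.IH Haus by (intro INT_complete_covers) auto
    moreover have "\<exists>C. complete_covers Z (\<Union>i. a i) C"
      using Union.IH by (intro UN_complete_covers) auto
    ultimately show ?case using Union.IH by auto
  qed
  then show ?thesis by blast
qed

section \<open>Countable bases and Borel graphs in Polish spaces\<close>

lemma polish_topology_prod:
  assumes "polish_topology S" "polish_topology T"
  shows "polish_topology (prod_topology S T)"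
  unfolding polish_topology_def
proof
  show "completely_metrizable_space (prod_topology S T)"
    using assms by (simp add: polish_topology_def completely_metrizable_space_prod_topology)
  obtain C D where "countable C" "C \<subseteq> topspace S" "S closure_of C = topspace S"
    "countable D" "D \<subseteq> topspace T" "T closure_of D = topspace T"
    using assms unfolding polish_topology_def separable_space_def by metis
  then show "separable_space (prod_topology S T)"
    unfolding separable_space_def
    by (intro exI[of _ "C \<times> D"]) (auto simp: closure_of_Times)
qed

lemma polish_topology_base:
  assumes "polish_topology T"
  obtains W :: "nat \<Rightarrow> 'a set" where "\<And>n. openin T (W n)"
    "\<And>U x. openin T U \<Longrightarrow> x \<in> U \<Longrightarrow> \<exists>n. x \<in> W n \<and> W n \<subseteq> U"
proof -
  obtain M d where Md: "Metric_space M d" "T = Metric_space.mtopology M d"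
    using assms unfolding polish_topology_def completely_metrizable_space_def by blast
  interpret Metric_space M d by (rule Md(1))
  have T: "T = mtopology" by (rule Md(2))
  obtain Q where Q: "countable Q" "Q \<subseteq> M" "mtopology closure_of Q = M"
    using assms unfolding polish_topology_def separable_space_def T by auto
  define W where "W n = (case prod_decode n of (k, j) \<Rightarrow> mball (from_nat_into Q k) (1 / Suc j))" for n
  show thesis
  proof (rule that)
    show "openin T (W n)" for n unfolding T W_def by (auto split: prod.splits)
    fix U x assume U: "openin T U" "x \<in> U"
    then obtain r where r: "r > 0" "mball x r \<subseteq> U" and xM: "x \<in> M"
      unfolding T openin_mtopology by blast
    obtain j :: nat where "2 / r < j" using reals_Archimedean2 by blast
    then have j: "2 / Suc j < r" using r(1) by (simp add: field_simps)
    have "x \<in> mtopology closure_of Q" using xM Q(3) by blast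
    then obtain y where y: "y \<in> Q" "d x y < 1 / Suc j"
      unfolding metric_closure_of by (auto dest!: spec[of _ "1 / Suc j"])
    then obtain k where k: "from_nat_into Q k = y" using Q(1) by (metis from_nat_into_surj)
    have W: "W (prod_encode (k, j)) = mball y (1 / Suc j)" by (simp add: W_def k)
    have "mball y (1 / Suc j) \<subseteq> mball x r"
    proof
      fix z assume z: "z \<in> mball y (1 / Suc j)"
      then have "d x z \<le> d x y + d y z" using xM by (intro triangle) auto
      moreover have "1 / real (Suc j) + 1 / Suc j = 2 / Suc j" by simp
      ultimately have "d x z < r" using z y(2) j by simp
      then show "z \<in> mball x r" using z xM by simp
    qed
    moreover have "x \<in> mball y (1 / Suc j)" using y xM Q(2) by (auto simp: commute)
    ultimately show "\<exists>n. x \<in> W n \<and> W n \<subseteq> U" using r(2) W by blast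
  qed
qed

text \<open>Intended for colourings, where the finite set consists of the other points of a
  neighbourhood in an orbit. Finite sets are closed, so a small basic set around the point avoids
  them.\<close>

lemma standard_borel_base:
  assumes "standard_borel M"
  obtains W :: "nat \<Rightarrow> 'a set" where "\<And>n. W n \<in> sets M"
    "\<And>x Q. x \<in> space M \<Longrightarrow> finite Q \<Longrightarrow> x \<notin> Q \<Longrightarrow> \<exists>n. x \<in> W n \<and> W n \<inter> Q = {}"
proof -
  obtain T where T: "polish_topology T" "topspace T = space M"
    "sets M = sigma_sets (space M) {U. openin T U}"
    using assms unfolding standard_borel_def by blast
  obtain W :: "nat \<Rightarrow> 'a set" where W: "\<And>n. openin T (W n)"
    "\<And>U x. openin T U \<Longrightarrow> x \<in> U \<Longrightarrow> \<exists>n. x \<in> W n \<and> W n \<subseteq> U"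
    using polish_topology_base[OF T(1)] by blast
  have "t1_space T"
    using T(1) completely_metrizable_imp_metrizable_space metrizable_imp_Hausdorff_space
      Hausdorff_imp_t1_space unfolding polish_topology_def by blast
  show thesis
  proof (rule that)
    show "W n \<in> sets M" for n unfolding T(3) by (rule sigma_sets.Basic) (simp add: W)
    fix x and Q :: "'a set" assume x: "x \<in> space M" "finite Q" "x \<notin> Q"
    have "closedin T (Q \<inter> topspace T)"
      using \<open>t1_space T\<close> x(2) by (simp add: t1_space_closedin_finite)
    then have "openin T (topspace T - Q)" using T(2) by (metis Diff_Int2 Diff_Int_distrib Int_commute Int_absorb openin_diff openin_topspace)
    then obtain n where n: "x \<in> W n" "W n \<subseteq> topspace T - Q" using W(2) x T(2) by (metis DiffI)
    then show "\<exists>n. x \<in> W n \<and> W n \<inter> Q = {}" by blast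
  qed
qed

text \<open>A countable base separates points, so the equation \<open>y = f x\<close> says that both
  sides lie in the same basic sets, which is a countable condition. The Borel sets of the product
  topology are used because complete covers are constructed for Borel sets of a Polish
  topology.\<close>

lemma graph_borel:
  assumes T: "polish_topology T" "topspace T = space M" "sets M = sigma_sets (space M) {U. openin T U}"
    and f: "f \<in> measurable M M" and A: "A \<in> sets M"
  shows "(\<lambda>x. (x, f x)) ` A \<in> sigma_sets (topspace (prod_topology T T)) {U. openin (prod_topology T T) U}"
proof -
  let ?Z = "prod_topology T T"
  define N where "N = sigma (topspace ?Z) {U. openin ?Z U}"
  have pow: "{U. openin ?Z U} \<subseteq> Pow (topspace ?Z)" using openin_subset by blast
  have sN: "sets N = sigma_sets (topspace ?Z) {U. openin ?Z U}"
    unfolding N_def by (rule sets_measure_of[OF pow])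
  have spN: "space N = topspace ?Z"
    unfolding N_def by (rule space_measure_of[OF pow])
  have meas: "g \<in> measurable N M" if g: "continuous_map ?Z T g" for g
  proof (rule measurableI)
    show "g z \<in> space M" if "z \<in> space N" for z
      using that g spN T(2) by (auto simp: continuous_map_def)
    fix B assume "B \<in> sets M"
    then have "B \<in> sigma_sets (space M) {U. openin T U}" using T(3) by simp
    then show "g -` B \<inter> space N \<in> sets N"
    proof (induction rule: sigma_sets.induct)
      case (Basic U)
      then have "openin ?Z {z \<in> topspace ?Z. g z \<in> U}"
        by (intro openin_continuous_map_preimage[OF g]) simp
      moreover have "{z \<in> topspace ?Z. g z \<in> U} = g -` U \<inter> space N" using spN by auto
      ultimately show ?case unfolding sN by (auto intro: sigma_sets.Basic)
    next
      case (Compl a)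
      have "g -` (space M - a) \<inter> space N = space N - (g -` a \<inter> space N)"
        using g spN T(2) by (auto simp: continuous_map_def)
      then show ?case using Compl by auto
    next
      case (Union a)
      have "g -` (\<Union>i. a i) \<inter> space N = (\<Union>i. g -` a i \<inter> space N)" by auto
      moreover have "(\<Union>i. g -` a i \<inter> space N) \<in> sets N"
        by (rule sets.countable_UN) (use Union.IH in blast)
      ultimately show ?case by (simp only:)
    qed simp
  qed
  have [measurable]: "fst \<in> measurable N M" "snd \<in> measurable N M"
    by (auto intro!: meas continuous_map_fst continuous_map_snd)
  note f[measurable] A[measurable]
  obtain W :: "nat \<Rightarrow> 'a set" where W: "\<And>n. openin T (W n)"
    "\<And>U x. openin T U \<Longrightarrow> x \<in> U \<Longrightarrow> \<exists>n. x \<in> W n \<and> W n \<subseteq> U"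
    using polish_topology_base[OF T(1)] by blast
  have W_sets[measurable]: "W n \<in> sets M" for n
    unfolding T(3) by (rule sigma_sets.Basic) (simp add: W)
  have Haus: "Hausdorff_space T"
    using T(1) completely_metrizable_imp_metrizable_space metrizable_imp_Hausdorff_space
    unfolding polish_topology_def by blast
  have "x = y" if xy: "x \<in> space M" "y \<in> space M" "\<And>n. x \<in> W n \<longleftrightarrow> y \<in> W n" for x y
  proof (rule ccontr)
    assume "x \<noteq> y"
    then obtain U V where "openin T U" "openin T V" "x \<in> U" "y \<in> V" "disjnt U V"
      using Haus xy T(2) unfolding Hausdorff_space_def by metis
    moreover from this obtain n where "x \<in> W n" "W n \<subseteq> U" using W(2) by metis
    ultimately show False using xy(3)[of n] unfolding disjnt_def by blast
  qed
  then have "(\<lambda>x. (x, f x)) ` A = {z \<in> space N. fst z \<in> A \<and> (\<forall>n. f (fst z) \<in> W n \<longleftrightarrow> snd z \<in> W n)}"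
    using sets.sets_into_space[OF A] measurable_space[OF f] spN T(2)
    by (auto simp: image_iff)
  moreover have "{z \<in> space N. fst z \<in> A \<and> (\<forall>n. f (fst z) \<in> W n \<longleftrightarrow> snd z \<in> W n)} \<in> sets N"
    by measurable
  ultimately show ?thesis using sN by simp
qed

text \<open>Lusin separation. If no measurable set separated the images, one could follow a branch through
  the two sequences of covers along which this remains true; the images of its two limits
  would be distinct, and disjoint neighbourhoods of them would separate.\<close>

lemma borel_images_separated:
  assumes T: "polish_topology T" "topspace T = space M" "sets M = sigma_sets (space M) {U. openin T U}"
    and GH: "G \<in> sigma_sets (topspace (prod_topology T T)) {U. openin (prod_topology T T) U}"
      "H \<in> sigma_sets (topspace (prod_topology T T)) {U. openin (prod_topology T T) U}"
    and disj: "snd ` G \<inter> snd ` H = {}"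
  shows "\<exists>S\<in>sets M. snd ` G \<subseteq> S \<and> S \<inter> snd ` H = {}"
proof (rule ccontr)
  let ?Z = "prod_topology T T"
  define sep where "sep P Q \<longleftrightarrow> (\<exists>S\<in>sets M. P \<subseteq> S \<and> S \<inter> Q = {})" for P Q
  assume "\<not> ?thesis"
  then have nsep: "\<not> sep (snd ` G) (snd ` H)" by (simp add: sep_def)
  have Zp: "polish_topology ?Z" using T by (simp add: polish_topology_prod)
  obtain C where C: "complete_covers ?Z G C" using borel_complete_covers[OF Zp GH(1)] by blast
  obtain D where D: "complete_covers ?Z H D" using borel_complete_covers[OF Zp GH(2)] by blast
  have pow: "{U. openin ?Z U} \<subseteq> Pow (topspace ?Z)" using openin_subset by blast
  have sub: "G \<subseteq> topspace T \<times> topspace T" "H \<subseteq> topspace T \<times> topspace T"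
    using sigma_sets_into_sp[OF pow GH(1)] sigma_sets_into_sp[OF pow GH(2)] by simp_all
  \<comment> \<open>If every pair of pieces were separated by some \<open>S k l\<close>, then the
    union over \<open>k\<close> of the intersections over \<open>l\<close> would separate
    \<open>snd\<close> P\<open>from\<close>snd \<open>Q\<close>.\<close>
  have split: "\<exists>k l. \<not> sep (snd ` (P \<inter> C n k)) (snd ` (Q \<inter> D n l))"
    if PQ: "P \<subseteq> G" "Q \<subseteq> H" "\<not> sep (snd ` P) (snd ` Q)" for P Q n
  proof (rule ccontr)
    assume "\<not> ?thesis"
    then obtain S where S: "\<And>k l. S k l \<in> sets M" "\<And>k l. snd ` (P \<inter> C n k) \<subseteq> S k l"
      "\<And>k l. S k l \<inter> snd ` (Q \<inter> D n l) = {}"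
      unfolding sep_def by metis
    let ?S = "\<Union>k. \<Inter>l. S k l"
    have "snd ` P \<subseteq> ?S"
    proof
      fix y assume "y \<in> snd ` P"
      then obtain z where z: "z \<in> P" "y = snd z" by blast
      then obtain k where "z \<in> C n k" using complete_covers_cover[OF C] PQ(1) by blast
      then have "y \<in> snd ` (P \<inter> C n k)" using z by blast
      then show "y \<in> ?S" using S(2) by blast
    qed
    moreover have "?S \<inter> snd ` Q = {}"
    proof -
      have "snd z \<notin> ?S" if "z \<in> Q" for z
      proof -
        obtain l where "z \<in> D n l" using complete_covers_cover[OF D] PQ(2) \<open>z \<in> Q\<close> by blast
        then have "snd z \<in> snd ` (Q \<inter> D n l)" using that by blast
        then show ?thesis using S(3) by blast
      qed
      then show ?thesis by blast
    qed
    moreover have "?S \<in> sets M" using S(1) by auto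
    ultimately show False using PQ(3) unfolding sep_def by blast
  qed
  \<comment> \<open>A state consists of the two current sets and the indices of the pieces chosen
    last; the branches \<alpha> and \<beta> are read off from these indices.\<close>
  have "\<exists>s. \<forall>n. (fst (s n) \<subseteq> G \<and> fst (snd (s n)) \<subseteq> H \<and> \<not> sep (snd ` fst (s n)) (snd ` fst (snd (s n))) \<and>
      (n = 0 \<longrightarrow> fst (s n) = G \<and> fst (snd (s n)) = H)) \<and>
      (fst (s (Suc n)) = fst (s n) \<inter> C n (fst (snd (snd (s (Suc n))))) \<and>
       fst (snd (s (Suc n))) = fst (snd (s n)) \<inter> D n (snd (snd (snd (s (Suc n))))))"
  proof (rule dependent_nat_choice)
    show "\<exists>x. fst x \<subseteq> G \<and> fst (snd x) \<subseteq> H \<and> \<not> sep (snd ` fst x) (snd ` fst (snd x)) \<and>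
        (0 = (0 :: nat) \<longrightarrow> fst x = G \<and> fst (snd x) = H)"
      by (rule exI[of _ "(G, H, undefined)"]) (simp add: nsep)
  next
    fix x :: "('a \<times> 'a) set \<times> ('a \<times> 'a) set \<times> nat \<times> nat" and n :: nat
    assume x: "fst x \<subseteq> G \<and> fst (snd x) \<subseteq> H \<and> \<not> sep (snd ` fst x) (snd ` fst (snd x)) \<and>
        (n = 0 \<longrightarrow> fst x = G \<and> fst (snd x) = H)"
    then obtain k l where "\<not> sep (snd ` (fst x \<inter> C n k)) (snd ` (fst (snd x) \<inter> D n l))"
      using split[of "fst x" "fst (snd x)" n] by blast
    then show "\<exists>y. (fst y \<subseteq> G \<and> fst (snd y) \<subseteq> H \<and> \<not> sep (snd ` fst y) (snd ` fst (snd y)) \<and>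
        (Suc n = 0 \<longrightarrow> fst y = G \<and> fst (snd y) = H)) \<and>
        fst y = fst x \<inter> C n (fst (snd (snd y))) \<and> fst (snd y) = fst (snd x) \<inter> D n (snd (snd (snd y)))"
      using x by (intro exI[of _ "(fst x \<inter> C n k, fst (snd x) \<inter> D n l, k, l)"]) auto
  qed
  then have "\<exists>s. (\<forall>n. \<not> sep (snd ` fst (s n)) (snd ` fst (snd (s n)))) \<and> fst (s 0) = G \<and> fst (snd (s 0)) = H \<and>
    (\<forall>n. fst (s (Suc n)) = fst (s n) \<inter> C n (fst (snd (snd (s (Suc n)))))) \<and>
    (\<forall>n. fst (snd (s (Suc n))) = fst (snd (s n)) \<inter> D n (snd (snd (snd (s (Suc n))))))"
    by (rule ex_forward) simp
  then obtain s where s: "\<forall>n. \<not> sep (snd ` fst (s n)) (snd ` fst (snd (s n)))"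
    "fst (s 0) = G" "fst (snd (s 0)) = H"
    "\<forall>n. fst (s (Suc n)) = fst (s n) \<inter> C n (fst (snd (snd (s (Suc n)))))"
    "\<forall>n. fst (snd (s (Suc n))) = fst (snd (s n)) \<inter> D n (snd (snd (snd (s (Suc n)))))"
    by (elim exE conjE)
  define \<alpha> where "\<alpha> n = fst (snd (snd (s (Suc n))))" for n
  define \<beta> where "\<beta> n = snd (snd (snd (s (Suc n))))" for n
  have E: "fst (s n) = G \<inter> (\<Inter>i<n. C i (\<alpha> i))" for n
  proof (induction n)
    case (Suc n)
    show ?case unfolding s(4)[rule_format, of n] Suc lessThan_Suc by (auto simp: \<alpha>_def)
  qed (simp add: s)
  have F: "fst (snd (s n)) = H \<inter> (\<Inter>i<n. D i (\<beta> i))" for n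
  proof (induction n)
    case (Suc n)
    show ?case unfolding s(5)[rule_format, of n] Suc lessThan_Suc by (auto simp: \<beta>_def)
  qed (simp add: s)
  have ns: "\<not> sep (snd ` (G \<inter> (\<Inter>i<n. C i (\<alpha> i)))) (snd ` (H \<inter> (\<Inter>i<n. D i (\<beta> i))))" for n
    using s(1)[rule_format, of n] unfolding E F .
  have sepE: "sep {} Q" "sep P {}" if "P \<subseteq> space M" for P Q
    unfolding sep_def using that by auto
  have spc: "snd ` (G \<inter> V) \<subseteq> space M" for V using sub T(2) by auto
  have neG: "G \<inter> (\<Inter>i<n. C i (\<alpha> i)) \<noteq> {}" for n
  proof
    assume "G \<inter> (\<Inter>i<n. C i (\<alpha> i)) = {}"
    with ns[of n] show False by (simp only: image_empty sepE(1)[OF empty_subsetI] not_True_eq_False)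
  qed
  have neH: "H \<inter> (\<Inter>i<n. D i (\<beta> i)) \<noteq> {}" for n
  proof
    assume "H \<inter> (\<Inter>i<n. D i (\<beta> i)) = {}"
    with ns[of n] show False by (simp only: image_empty sepE(2)[OF spc] not_True_eq_False)
  qed
  obtain z where z: "z \<in> G" "\<forall>U. openin ?Z U \<and> z \<in> U \<longrightarrow> (\<exists>n. G \<inter> (\<Inter>i<n. C i (\<alpha> i)) \<subseteq> U)"
    using complete_covers_limit[OF C, of \<alpha>, OF neG] by (rule bexE)
  obtain w where w: "w \<in> H" "\<forall>U. openin ?Z U \<and> w \<in> U \<longrightarrow> (\<exists>n. H \<inter> (\<Inter>i<n. D i (\<beta> i)) \<subseteq> U)"
    using complete_covers_limit[OF D, of \<beta>, OF neH] by (rule bexE)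
  have zw: "snd z \<noteq> snd w" "snd z \<in> topspace T" "snd w \<in> topspace T"
    using z(1) w(1) disj sub by auto
  have Haus: "Hausdorff_space T"
    using T(1) completely_metrizable_imp_metrizable_space metrizable_imp_Hausdorff_space
    unfolding polish_topology_def by blast
  obtain U V where UV: "openin T U" "openin T V" "snd z \<in> U" "snd w \<in> V" "disjnt U V"
    using Haus zw unfolding Hausdorff_space_def by metis
  have opn: "openin ?Z (topspace T \<times> U)" "openin ?Z (topspace T \<times> V)"
    using UV by (auto simp: openin_prod_Times_iff)
  have mem: "z \<in> topspace T \<times> U" "w \<in> topspace T \<times> V"
    using z(1) w(1) sub UV by (auto simp: mem_Times_iff)
  obtain m where m: "G \<inter> (\<Inter>i<m. C i (\<alpha> i)) \<subseteq> topspace T \<times> U"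
    using z(2)[rule_format, OF conjI[OF opn(1) mem(1)]] by (rule exE)
  obtain n where n: "H \<inter> (\<Inter>i<n. D i (\<beta> i)) \<subseteq> topspace T \<times> V"
    using w(2)[rule_format, OF conjI[OF opn(2) mem(2)]] by (rule exE)
  let ?k = "max m n"
  have "G \<inter> (\<Inter>i<?k. C i (\<alpha> i)) \<subseteq> topspace T \<times> U"
    by (rule subset_trans[OF _ m]) auto
  moreover have "H \<inter> (\<Inter>i<?k. D i (\<beta> i)) \<subseteq> topspace T \<times> V"
    by (rule subset_trans[OF _ n]) auto
  ultimately have "snd ` (G \<inter> (\<Inter>i<?k. C i (\<alpha> i))) \<subseteq> U" "U \<inter> snd ` (H \<inter> (\<Inter>i<?k. D i (\<beta> i))) = {}"
    using UV(5) unfolding disjnt_def by fastforce+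
  moreover have "U \<in> sets M" unfolding T(3) using UV(1) by (auto intro: sigma_sets.Basic)
  ultimately show False using ns[of ?k] unfolding sep_def by blast
qed

text \<open>The images of a measurable set and of its complement are disjoint projections of Borel
  graphs, so a measurable set separates them. Since the two images exhaust the space, the separating
  set is the image itself, which is the preimage under the inverse.\<close>

lemma standard_borel_measurable_inv:
  assumes M: "standard_borel M" and f: "f \<in> measurable M M" "bij_betw f (space M) (space M)"
  shows "inv_into (space M) f \<in> measurable M M"
proof (rule measurableI)
  show "inv_into (space M) f x \<in> space M" if "x \<in> space M" for x
    using that f(2) by (metis bij_betw_inv_into bij_betwE)
  fix A assume A: "A \<in> sets M"
  obtain T where T: "polish_topology T" "topspace T = space M"
    "sets M = sigma_sets (space M) {U. openin T U}"
    using M unfolding standard_borel_def by blast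
  have AM: "A \<subseteq> space M" using A sets.sets_into_space by blast
  have inj: "inj_on f (space M)" and surj: "f ` space M = space M"
    using f(2) by (auto simp: bij_betw_def)
  let ?g = "\<lambda>x. (x, f x)"
  have img: "snd ` ?g ` X = f ` X" for X by force
  have "f ` A \<inter> f ` (space M - A) = {}" using inj AM by (auto dest: inj_onD)
  then obtain S where S: "S \<in> sets M" "f ` A \<subseteq> S" "S \<inter> f ` (space M - A) = {}"
    using borel_images_separated[OF T graph_borel[OF T f(1) A] graph_borel[OF T f(1) sets.compl_sets[OF A]]]
    unfolding img by blast
  have "S \<subseteq> f ` space M" using S(1) sets.sets_into_space surj by auto
  then have "S = f ` A" using S AM by blast
  moreover have "inv_into (space M) f -` A \<inter> space M = f ` A"
  proof (intro equalityI subsetI)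
    fix y assume "y \<in> inv_into (space M) f -` A \<inter> space M"
    then show "y \<in> f ` A" by (intro image_eqI[of _ _ "inv_into (space M) f y"]) (simp_all add: f_inv_into_f surj)
  next
    fix y assume "y \<in> f ` A"
    then obtain x where "x \<in> A" "y = f x" by blast
    then show "y \<in> inv_into (space M) f -` A \<inter> space M"
      using AM inj surj by (auto simp: inv_into_f_f subset_iff)
  qed
  ultimately show "inv_into (space M) f -` A \<inter> space M \<in> sets M" using S(1) by simp
qed

section \<open>The action of the lattice\<close>

lemma countable_lattice: "countable (lattice d)"
proof (rule countableI')
  show "inj_on (\<lambda>z. map z [0..<d]) (lattice d)"
  proof (rule inj_onI)
    fix v w assume vw: "v \<in> lattice d" "w \<in> lattice d" "map v [0..<d] = map w [0..<d]"
    show "v = w"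
    proof
      fix i show "v i = w i" using vw by (cases "i < d") (auto simp: lattice_def)
    qed
  qed
qed

lemma lattice_zero [simp]: "0 \<in> lattice d"
  and lattice_add: "v \<in> lattice d \<Longrightarrow> w \<in> lattice d \<Longrightarrow> v + w \<in> lattice d"
  and lattice_diff: "v \<in> lattice d \<Longrightarrow> w \<in> lattice d \<Longrightarrow> v - w \<in> lattice d"
  and lattice_uminus: "v \<in> lattice d \<Longrightarrow> - v \<in> lattice d"
  and axis_vec_lattice: "i < d \<Longrightarrow> axis_vec i k \<in> lattice d"
  by (auto simp: lattice_def axis_vec_def)

context
  fixes X :: "'a set" and f :: "'a \<Rightarrow> 'a"
  assumes f: "bij_betw f X X"
begin

lemma bij_inv_into_self:
  "x \<in> X \<Longrightarrow> f x \<in> X" "x \<in> X \<Longrightarrow> inv_into X f x \<in> X"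
  "x \<in> X \<Longrightarrow> f (inv_into X f x) = x" "x \<in> X \<Longrightarrow> inv_into X f (f x) = x"
  using f bij_betw_inv_into[OF f]
  by (auto simp: bij_betwE bij_betw_inv_into_right bij_betw_inv_into_left)

lemma int_iterate_closed:
  assumes "x \<in> X" shows "int_iterate X f k x \<in> X"
proof -
  have "(f ^^ n) x \<in> X" "(inv_into X f ^^ n) x \<in> X" for n
    by (induction n) (auto simp: assms bij_inv_into_self)
  then show ?thesis by (simp add: int_iterate_def)
qed

lemma int_iterate_0: "int_iterate X f 0 x = x"
  by (simp add: int_iterate_def)

lemma int_iterate_plus1:
  assumes "x \<in> X" shows "int_iterate X f (k + 1) x = f (int_iterate X f k x)"
proof (cases "0 \<le> k")
  case True
  then have "nat (k + 1) = Suc (nat k)" by simp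
  then show ?thesis using True by (simp add: int_iterate_def)
next
  case False
  then have eq: "nat (- k) = Suc (nat (- (k + 1)))" by simp
  have "int_iterate X f k x = inv_into X f (int_iterate X f (k + 1) x)"
    using False by (cases "k = -1") (simp_all add: int_iterate_def eq)
  then show ?thesis using assms by (simp add: int_iterate_closed bij_inv_into_self)
qed

lemma int_iterate_minus1:
  assumes "x \<in> X" shows "int_iterate X f (k - 1) x = inv_into X f (int_iterate X f k x)"
  using int_iterate_plus1[OF assms, of "k - 1"] assms
  by (simp add: int_iterate_closed bij_inv_into_self)

lemma int_iterate_add:
  assumes "x \<in> X" shows "int_iterate X f (j + k) x = int_iterate X f j (int_iterate X f k x)"
proof (induction j rule: int_induct[of _ 0])
  case (step1 i)
  have "int_iterate X f (i + 1 + k) x = int_iterate X f (i + k + 1) x" by (simp add: add_ac)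
  then show ?case using step1 assms by (simp add: int_iterate_plus1 int_iterate_closed)
next
  case (step2 i)
  have "int_iterate X f (i - 1 + k) x = int_iterate X f (i + k - 1) x" by (simp add: algebra_simps)
  then show ?case using step2 assms by (simp add: int_iterate_minus1 int_iterate_closed)
qed (simp add: int_iterate_0)

text \<open>Cancelling \<open>f\<close> shows that a map commuting with \<open>f\<close> also
  commutes with its inverse, which carries the induction to negative exponents.\<close>

lemma int_iterate_commute1:
  assumes g: "\<And>x. x \<in> X \<Longrightarrow> g x \<in> X" "\<And>x. x \<in> X \<Longrightarrow> g (f x) = f (g x)" and "x \<in> X"
  shows "g (int_iterate X f k x) = int_iterate X f k (g x)"
proof (induction k rule: int_induct[of _ 0])
  case (step1 i)
  then show ?case using assms by (simp add: int_iterate_plus1 int_iterate_closed)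
next
  case (step2 i)
  let ?y = "int_iterate X f i x"
  have "?y \<in> X" using assms by (simp add: int_iterate_closed)
  then have "f (g (inv_into X f ?y)) = g ?y" using g by (metis bij_inv_into_self(2,3))
  then have "g (inv_into X f ?y) = inv_into X f (g ?y)"
    using g \<open>?y \<in> X\<close> by (metis bij_inv_into_self(2,4))
  then show ?case using step2 assms by (simp add: int_iterate_minus1 int_iterate_closed)
qed (simp add: int_iterate_0)

end

section \<open>Orbits as copies of the lattice\<close>

locale free_lattice_action =
  fixes d :: nat and M :: "'a measure" and \<phi> :: "nat \<Rightarrow> 'a \<Rightarrow> 'a"
  assumes free_action: "free_borel_action d M \<phi>"
begin

abbreviation "\<psi> i \<equiv> inv_into (space M) (\<phi> i)"
abbreviation "act \<equiv> lattice_act (space M) \<phi> d"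

lemma standard: "standard_borel M"
  and bij_generator: "i < d \<Longrightarrow> bij_betw (\<phi> i) (space M) (space M)"
  and generator_commute: "i < d \<Longrightarrow> j < d \<Longrightarrow> x \<in> space M \<Longrightarrow> \<phi> i (\<phi> j x) = \<phi> j (\<phi> i x)"
  and measurable_generator: "i < d \<Longrightarrow> \<phi> i \<in> measurable M M"
  using free_action by (auto simp: free_borel_action_def)

lemma measurable_inv_generator: "i < d \<Longrightarrow> \<psi> i \<in> measurable M M"
  by (intro standard_borel_measurable_inv standard measurable_generator bij_generator)

lemma generator_simps [simp]:
  assumes "i < d" "x \<in> space M"
  shows "\<phi> i x \<in> space M" "\<psi> i x \<in> space M" "\<phi> i (\<psi> i x) = x" "\<psi> i (\<phi> i x) = x"
  using bij_inv_into_self[OF bij_generator[OF assms(1)] assms(2)] by auto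

lemma generator_inv_commute:
  assumes "i < d" "j < d" "x \<in> space M"
  shows "\<phi> i (\<psi> j x) = \<psi> j (\<phi> i x)"
proof -
  have "\<psi> j (\<phi> j (\<phi> i (\<psi> j x))) = \<psi> j (\<phi> i (\<phi> j (\<psi> j x)))"
    using assms by (subst generator_commute) simp_all
  then show ?thesis using assms by simp
qed

lemma partial_act_closed: "n \<le> d \<Longrightarrow> x \<in> space M \<Longrightarrow> lattice_act (space M) \<phi> n z x \<in> space M"
  by (induction n) (auto intro!: int_iterate_closed[OF bij_generator])

lemma act_closed [simp]: "x \<in> space M \<Longrightarrow> act z x \<in> space M"
  by (simp add: partial_act_closed)

lemma int_iterate_commute:
  assumes "i < d" "j < d" "x \<in> space M"
  shows "int_iterate (space M) (\<phi> i) k (int_iterate (space M) (\<phi> j) l x) =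
    int_iterate (space M) (\<phi> j) l (int_iterate (space M) (\<phi> i) k x)"
  using assms
  by (intro int_iterate_commute1 bij_generator int_iterate_closed
      int_iterate_commute1[OF bij_generator, symmetric])
    (auto intro: generator_commute)

lemma int_iterate_act_commute:
  assumes "i < d" "x \<in> space M" "n \<le> d"
  shows "int_iterate (space M) (\<phi> i) k (lattice_act (space M) \<phi> n z x) =
    lattice_act (space M) \<phi> n z (int_iterate (space M) (\<phi> i) k x)"
  using assms(3)
proof (induction n)
  case (Suc n)
  then have n: "n < d" "n \<le> d" by auto
  then show ?case using assms(1,2) Suc.IH
    by (simp add: int_iterate_commute[of i n] partial_act_closed)
qed simp

text \<open>The action is composed one coordinate at a time, so the last coordinate of
  \<open>w\<close> must be moved past the lower coordinates of \<open>v\<close>. This is where the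
  generators have to commute.\<close>

lemma act_add:
  assumes "x \<in> space M"
  shows "act (v + w) x = act v (act w x)"
proof -
  have "lattice_act (space M) \<phi> n (v + w) x = lattice_act (space M) \<phi> n v (lattice_act (space M) \<phi> n w x)"
    if "n \<le> d" for n
    using that
  proof (induction n)
    case (Suc n)
    then have n: "n < d" "n \<le> d" by auto
    then show ?case using assms Suc.IH
      by (simp add: int_iterate_add[OF bij_generator] partial_act_closed
          int_iterate_act_commute[of n "lattice_act (space M) \<phi> n w x"])
  qed simp
  then show ?thesis by simp
qed

lemma act_zero [simp]: "act 0 x = x"
proof -
  have "lattice_act (space M) \<phi> n 0 x = x" for n
    by (induction n) (simp_all add: int_iterate_def)
  then show ?thesis .
qed

lemma act_axis_vec:
  assumes "i < d"
  shows "act (axis_vec i k) x = int_iterate (space M) (\<phi> i) k x"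
proof -
  have "lattice_act (space M) \<phi> n (axis_vec i k) x = (if i < n then int_iterate (space M) (\<phi> i) k x else x)" for n
    by (induction n) (auto simp: axis_vec_def int_iterate_def less_Suc_eq)
  then show ?thesis using assms by simp
qed

lemma act_axis_vec_one:
  assumes "i < d"
  shows "act (axis_vec i 1) x = \<phi> i x" "act (axis_vec i (- 1)) x = \<psi> i x"
  using assms by (simp_all add: act_axis_vec int_iterate_def)

lemma act_uminus:
  assumes "x \<in> space M"
  shows "act (- z) (act z x) = x" "act z (act (- z) x) = x"
  using assms act_add[of x "- z" z] act_add[of x z "- z"] by simp_all

lemma act_eq_self:
  assumes "x \<in> space M" "z \<in> lattice d" "act z x = x"
  shows "z = 0"
  using assms free_action unfolding free_borel_action_def zero_fun_def by blast

text \<open>Freeness applied to the difference of the vectors. It allows statements about the points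
  of an orbit to be read as statements about lattice vectors.\<close>

lemma act_inj:
  assumes "x \<in> space M" "v \<in> lattice d" "w \<in> lattice d" "act v x = act w x"
  shows "v = w"
proof -
  have "act (v - w) x = act (- w) (act v x)" using act_add[OF assms(1), of "- w" v] by simp
  also have "\<dots> = x" using assms by (simp add: act_uminus)
  finally have "v - w = 0" using assms act_eq_self lattice_diff by metis
  then show ?thesis by simp
qed

lemma measurable_act: "act z \<in> measurable M M"
proof -
  have fn: "f ^^ n \<in> measurable M M" if [measurable]: "f \<in> measurable M M" for f :: "'a \<Rightarrow> 'a" and n
    by (induction n) (simp_all add: id_def measurable_comp)
  have "lattice_act (space M) \<phi> n z \<in> measurable M M" if "n \<le> d" for n
    using that
  proof (induction n)
    case (Suc n)
    have "int_iterate (space M) (\<phi> n) (z n) \<in> measurable M M"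
      unfolding int_iterate_def using Suc.prems
      by (auto intro!: fn measurable_generator measurable_inv_generator)
    then have "int_iterate (space M) (\<phi> n) (z n) \<circ> lattice_act (space M) \<phi> n z \<in> measurable M M"
      using Suc by (intro measurable_comp) auto
    then show ?case by (simp add: comp_def cong: measurable_cong)
  qed (simp add: cong: measurable_cong)
  then show ?thesis by simp
qed

end

lemma pred_Bex_countable:
  assumes "countable I" "\<And>i. i \<in> I \<Longrightarrow> Measurable.pred M (P i)"
  shows "Measurable.pred M (\<lambda>x. \<exists>i\<in>I. P i x)"
proof -
  have "{x \<in> space M. \<exists>i\<in>I. P i x} = (\<Union>i\<in>I. {x \<in> space M. P i x})" by auto
  then show ?thesis using assms unfolding pred_def by (auto intro!: sets.countable_UN')
qed

section \<open>Components of scaled ball coverings\<close>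

definition cube :: "nat \<Rightarrow> int \<Rightarrow> (nat \<Rightarrow> int) set" where
  "cube d r = {z \<in> lattice d. \<forall>i<d. \<bar>z i\<bar> \<le> r}"

lemma cube_lattice: "z \<in> cube d r \<Longrightarrow> z \<in> lattice d"
  by (simp add: cube_def)

lemma zero_cube [simp]: "0 \<le> r \<Longrightarrow> 0 \<in> cube d r"
  by (simp add: cube_def)

lemma cube_mono: "z \<in> cube d r \<Longrightarrow> r \<le> s \<Longrightarrow> z \<in> cube d s"
  by (fastforce simp: cube_def)

lemma cube_uminus: "z \<in> cube d r \<Longrightarrow> - z \<in> cube d r"
  by (simp add: cube_def lattice_uminus)

lemma cube_sym: "v - w \<in> cube d r \<Longrightarrow> w - v \<in> cube d r"
  using cube_uminus[of "v - w"] by simp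

lemma cube_add: "v \<in> cube d r \<Longrightarrow> w \<in> cube d s \<Longrightarrow> v + w \<in> cube d (r + s)"
  by (fastforce simp: cube_def lattice_add)

lemma cube_triangle:
  "u - v \<in> cube d r \<Longrightarrow> v - w \<in> cube d s \<Longrightarrow> r + s \<le> t \<Longrightarrow> u - w \<in> cube d t"
  using cube_mono[OF cube_add[of "u - v" d r "v - w" s]] by simp

text \<open>Division of the coordinates by \<open>R\<close> leaves 21 quotients, from -10 to 10, and
  points with equal quotients differ by at most \<open>R\<close> in every coordinate.\<close>

lemma cube_packing:
  assumes "0 < R" "S \<subseteq> cube d (10 * R)"
    and sep: "\<And>v w. v \<in> S \<Longrightarrow> w \<in> S \<Longrightarrow> v - w \<in> cube d R \<Longrightarrow> v = w"
  shows "finite S" "card S \<le> 21 ^ d"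
proof -
  let ?f = "\<lambda>v. restrict (\<lambda>i. v i div R) {..<d}"
  let ?P = "{..<d} \<rightarrow>\<^sub>E {-10..10 :: int}"
  have P: "finite ?P" "card ?P = 21 ^ d" by (simp_all add: finite_PiE card_PiE)
  have sub: "?f ` S \<subseteq> ?P"
  proof (rule image_subsetI)
    fix v assume "v \<in> S"
    have "v i div R \<in> {-10..10}" if "i < d" for i
    proof -
      have "- (10 * R) \<le> v i" "v i \<le> 10 * R"
        using assms(2) \<open>v \<in> S\<close> that by (fastforce simp: cube_def)+
      then have "- (10 * R) div R \<le> v i div R" "v i div R \<le> 10 * R div R"
        using assms(1) by (intro zdiv_mono1; simp)+
      moreover have "- (10 * R) div R = - 10"
        using assms(1) nonzero_mult_div_cancel_right[of R "- 10"] by simp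
      ultimately show ?thesis using assms(1) by simp
    qed
    then show "?f v \<in> ?P" by (auto simp: PiE_iff)
  qed
  have inj: "inj_on ?f S"
  proof (rule inj_onI)
    fix v w assume vw: "v \<in> S" "w \<in> S" "?f v = ?f w"
    have "\<bar>v i - w i\<bar> \<le> R" if "i < d" for i
    proof -
      have eq: "v i div R = w i div R" using vw(3) that by (metis lessThan_iff restrict_apply')
      have "R * (w i div R) + v i mod R = v i" "R * (w i div R) + w i mod R = w i"
        using mult_div_mod_eq[of R "v i", unfolded eq] by simp_all
      moreover have "0 \<le> v i mod R" "v i mod R < R" "0 \<le> w i mod R" "w i mod R < R"
        using assms(1) by simp_all
      ultimately show ?thesis by linarith
    qed
    moreover have "v - w \<in> lattice d" using vw(1,2) assms(2) cube_lattice by (intro lattice_diff) blast+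
    ultimately show "v = w" using sep vw by (simp add: cube_def)
  qed
  show "finite S" by (rule finite_imageD[OF finite_subset[OF sub P(1)] inj])
  show "card S \<le> 21 ^ d" using card_inj_on_le[OF inj sub P(1)] P(2) by simp
qed

lemma finite_cube: "finite (cube d r)"
proof (rule finite_subset)
  let ?g = "\<lambda>f i. if i < d then f i else (0 :: int)"
  show "cube d r \<subseteq> ?g ` ({..<d} \<rightarrow>\<^sub>E {- r..r})"
  proof
    fix z assume z: "z \<in> cube d r"
    then have "z = ?g (restrict z {..<d})" by (auto simp: cube_def lattice_def fun_eq_iff)
    moreover have "restrict z {..<d} \<in> {..<d} \<rightarrow>\<^sub>E {- r..r}" using z by (auto simp: cube_def abs_le_iff)
    ultimately show "z \<in> ?g ` ({..<d} \<rightarrow>\<^sub>E {- r..r})" by blast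
  qed
  show "finite (?g ` ({..<d} \<rightarrow>\<^sub>E {- r..r}))" by (intro finite_imageI finite_PiE) auto
qed

lemma finite_translate_cube: "finite {w. w - c \<in> cube d r}"
proof -
  have "{w. w - c \<in> cube d r} \<subseteq> (\<lambda>z. z + c) ` cube d r"
  proof
    fix w assume "w \<in> {w. w - c \<in> cube d r}"
    then show "w \<in> (\<lambda>z. z + c) ` cube d r" by (intro image_eqI[of _ _ "w - c"]) auto
  qed
  then show ?thesis by (rule finite_subset) (intro finite_imageI finite_cube)
qed

section \<open>Components with respect to bounded jumps\<close>

definition link :: "nat \<Rightarrow> int \<Rightarrow> (nat \<Rightarrow> int) set \<Rightarrow> ((nat \<Rightarrow> int) \<times> (nat \<Rightarrow> int)) set" where
  "link d r P = {(v, w). v \<in> P \<and> w \<in> P \<and> w - v \<in> cube d r}"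

definition finite_components :: "nat \<Rightarrow> int \<Rightarrow> (nat \<Rightarrow> int) set \<Rightarrow> bool" where
  "finite_components d r P \<longleftrightarrow> (\<forall>v\<in>P. finite {w. (v, w) \<in> (link d r P)\<^sup>*})"

lemma finite_components_subset:
  assumes "finite_components d r P" "P' \<subseteq> P" "r' \<le> r"
  shows "finite_components d r' P'"
  unfolding finite_components_def
proof
  fix v assume v: "v \<in> P'"
  have "(link d r' P')\<^sup>* \<subseteq> (link d r P)\<^sup>*"
    using assms(2,3) by (intro rtrancl_mono) (auto simp: link_def intro: cube_mono)
  then have "{w. (v, w) \<in> (link d r' P')\<^sup>*} \<subseteq> {w. (v, w) \<in> (link d r P)\<^sup>*}" by blast
  moreover have "finite {w. (v, w) \<in> (link d r P)\<^sup>*}"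
    using assms(1,2) v unfolding finite_components_def by blast
  ultimately show "finite {w. (v, w) \<in> (link d r' P')\<^sup>*}" by (rule finite_subset)
qed

text \<open>Balls of radius \<open>8 * Q n\<close> around the points of \<open>C n\<close>, for rapidly growing \<open>Q\<close>. A lattice
  point is core if it lies in the ball of least scale containing it but not in the boundary
  shell of thickness \<open>r\<close> of that ball. A path in the core never changes balls; a path of
  shell points that starts deep inside a ball of scale \<open>n\<close> runs through balls of scales
  less than \<open>n\<close> only and hence cannot get far.\<close>

locale scaled_balls =
  fixes d :: nat and r :: int and Q :: "nat \<Rightarrow> int" and C :: "nat \<Rightarrow> (nat \<Rightarrow> int) set"
  assumes r_nonneg: "0 \<le> r" and Q_0: "2 * r \<le> Q 0" and Q_Suc: "16 * Q n \<le> Q (Suc n)"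
    and centres_apart: "b \<in> C n \<Longrightarrow> c \<in> C n \<Longrightarrow> b - c \<in> cube d (40 * Q n) \<Longrightarrow> b = c"
begin

lemma Q_bounds: "2 * r \<le> Q n" "0 \<le> Q n"
proof -
  show "2 * r \<le> Q n"
  proof (induction n)
    case (Suc n)
    then show ?case using Q_Suc[of n] r_nonneg by linarith
  qed (rule Q_0)
  then show "0 \<le> Q n" using r_nonneg by linarith
qed

definition lower :: "nat \<Rightarrow> (nat \<Rightarrow> int) set" where
  "lower n = {v. \<exists>m<n. \<exists>c\<in>C m. v - c \<in> cube d (8 * Q m)}"

definition core :: "(nat \<Rightarrow> int) set" where
  "core = {v \<in> lattice d. \<exists>n. \<exists>c\<in>C n. v - c \<in> cube d (8 * Q n - r) \<and> v \<notin> lower n}"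

lemma lower_Suc: "v \<in> lower (Suc n) \<longleftrightarrow> v \<in> lower n \<or> (\<exists>c\<in>C n. v - c \<in> cube d (8 * Q n))"
  by (auto simp: lower_def less_Suc_eq)

lemma lower_components_bounded:
  "(v, w) \<in> (link d r (lower n))\<^sup>* \<Longrightarrow> w - v \<in> cube d (2 * Q n)"
proof (induction n arbitrary: v w)
  case 0
  have "link d r (lower 0) = {}" by (simp add: link_def lower_def)
  then have "w - v = 0" using 0 by (simp only: rtrancl_empty IdD diff_self pair_in_Id_conv)
  then show ?case using Q_bounds(2)[of 0] by (simp only: zero_cube mult_nonneg_nonneg zero_le_numeral)
next
  case (Suc n)
  let ?L = "(link d r (lower n))\<^sup>*"
  \<comment> \<open>Invariant of a path from \<open>v\<close> to \<open>w\<close>: either smaller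
    balls alone connect them, or there is a centre \<open>c\<close> of scale \<open>n\<close> such
    that \<open>w\<close> lies in its ball or is reached by an excursion through smaller balls from
    a point \<open>u\<close> within one step of that ball. In units of \<open>Q n\<close>, 9 is the
    radius 8 plus room for a step, and 11 is 9 plus the bound 2 for paths through smaller
    balls.\<close>
  define J where "J w \<longleftrightarrow> (v, w) \<in> ?L \<or> (\<exists>c\<in>C n. v - c \<in> cube d (11 * Q n) \<and>
      (w - c \<in> cube d (8 * Q n) \<or> (\<exists>u. u - c \<in> cube d (9 * Q n) \<and> (u, w) \<in> ?L)))" for w
  note Q = Q_bounds[of n] r_nonneg
  have near: "v - w \<in> cube d (2 * Q n) \<or> (\<exists>c\<in>C n. v - c \<in> cube d (11 * Q n) \<and> w - c \<in> cube d (11 * Q n))"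
    if "J w" for w
    using that unfolding J_def
  proof (elim disjE bexE conjE exE)
    assume "(v, w) \<in> ?L" then show ?thesis using Suc.IH cube_sym by blast
  next
    fix c assume "c \<in> C n" "v - c \<in> cube d (11 * Q n)" "w - c \<in> cube d (8 * Q n)"
    then show ?thesis using Q(2) cube_mono[of "w - c" d "8 * Q n" "11 * Q n"] by auto
  next
    fix c u assume c: "c \<in> C n" "v - c \<in> cube d (11 * Q n)" and u: "u - c \<in> cube d (9 * Q n)" "(u, w) \<in> ?L"
    have "w - c \<in> cube d (11 * Q n)"
      by (rule cube_triangle[OF Suc.IH[OF u(2)] u(1)]) simp
    then show ?thesis using c by blast
  qed
  \<comment> \<open>A path attached to a centre \<open>b\<close> cannot enter the ball of another
    centre \<open>c\<close>, since their distance would be at most 11 + 9 units, below the required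
    40.\<close>
  have enter: "v - c \<in> cube d (11 * Q n)"
    if "J w" "w' - w \<in> cube d r" "c \<in> C n" "w' - c \<in> cube d (8 * Q n)" for w w' c
  proof -
    have wc: "w - c \<in> cube d (9 * Q n)"
      by (rule cube_triangle[OF cube_sym[OF that(2)] that(4)]) (use Q in linarith)
    show ?thesis using near[OF that(1)]
    proof (elim disjE bexE conjE)
      assume "v - w \<in> cube d (2 * Q n)"
      then show ?thesis by (rule cube_triangle[OF _ wc]) simp
    next
      fix b assume b: "b \<in> C n" "v - b \<in> cube d (11 * Q n)" "w - b \<in> cube d (11 * Q n)"
      have "b - c \<in> cube d (40 * Q n)"
        by (rule cube_triangle[OF cube_sym[OF b(3)] wc]) (use Q in linarith)
      then show ?thesis using centres_apart b that(3) by blast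
    qed
  qed
  have "J w"
    using Suc.prems
  proof (induction rule: rtrancl_induct)
    case base
    then show ?case by (simp add: J_def)
  next
    case (step w w')
    then have w: "w \<in> lower (Suc n)" "w' \<in> lower (Suc n)" "w' - w \<in> cube d r"
      by (auto simp: link_def)
    show ?case
    proof (cases "w' \<in> lower n")
      case False
      then obtain c where c: "c \<in> C n" "w' - c \<in> cube d (8 * Q n)" using w lower_Suc by blast
      then show ?thesis using enter[OF step.IH w(3)] unfolding J_def by blast
    next
      case True
      show ?thesis
      proof (cases "w \<in> lower n")
        case w_low: True
        then have "(w, w') \<in> link d r (lower n)" using True w by (simp add: link_def)
        then have ext: "(u, w') \<in> ?L" if "(u, w) \<in> ?L" for u using that by (rule rtrancl_into_rtrancl[rotated])
        have "w - c \<in> cube d (8 * Q n) \<Longrightarrow> w - c \<in> cube d (9 * Q n)" for c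
          using Q by (auto intro: cube_mono)
        then show ?thesis using step.IH ext[of w] ext unfolding J_def by blast
      next
        case False
        then obtain c where c: "c \<in> C n" "w - c \<in> cube d (8 * Q n)" using w lower_Suc by blast
        have "v - c \<in> cube d (11 * Q n)" using enter[OF step.IH _ c] r_nonneg by simp
        moreover have "w' - c \<in> cube d (9 * Q n)"
          by (rule cube_triangle[OF w(3) c(2)]) (use Q in linarith)
        ultimately show ?thesis using c unfolding J_def by blast
      qed
    qed
  qed
  from near[OF this] show ?case
  proof (elim disjE bexE conjE)
    assume "v - w \<in> cube d (2 * Q n)"
    then show ?thesis
      by (rule cube_sym[OF cube_mono]) (use Q Q_Suc[of n] in linarith)
  next
    fix c assume c: "v - c \<in> cube d (11 * Q n)" "w - c \<in> cube d (11 * Q n)"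
    \<comment> \<open>Both ends are within 11 units of \<open>c\<close>, and 22 is less than twice
      the growth factor 16 of the scales.\<close>
    show ?thesis
      by (rule cube_triangle[OF c(2) cube_sym[OF c(1)]]) (use Q Q_Suc[of n] in linarith)
  qed
qed

text \<open>A step from the inner part of a ball does not leave the ball, by the thickness of the
  shell. If consecutive core points belonged to different scales, the one of larger scale would thus
  lie in a ball of smaller scale, against the choice of the least scale. For equal scales the
  centres agree because they are sparse.\<close>

lemma finite_components_core: "finite_components d r core"
  unfolding finite_components_def
proof
  fix v assume "v \<in> core"
  then obtain n c where nc: "c \<in> C n" "v - c \<in> cube d (8 * Q n - r)" "v \<notin> lower n"
    unfolding core_def by blast
  have in_ball: "w - b \<in> cube d (8 * Q m)" if "w - b \<in> cube d (8 * Q m - r)" for w b m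
    using that r_nonneg by (auto intro: cube_mono)
  have "w - c \<in> cube d (8 * Q n - r) \<and> w \<notin> lower n" if "(v, w) \<in> (link d r core)\<^sup>*" for w
    using that
  proof (induction rule: rtrancl_induct)
    case (step w w')
    then have w': "w' \<in> core" "w' - w \<in> cube d r" by (auto simp: link_def)
    then obtain m b where mb: "b \<in> C m" "w' - b \<in> cube d (8 * Q m - r)" "w' \<notin> lower m"
      unfolding core_def by blast
    have 1: "w' - c \<in> cube d (8 * Q n)"
      by (rule cube_triangle[OF w'(2) conjunct1[OF step.IH]]) simp
    have 2: "w - b \<in> cube d (8 * Q m)"
      by (rule cube_triangle[OF cube_sym[OF w'(2)] mb(2)]) simp
    have "\<not> n < m" using 1 mb(3) nc(1) unfolding lower_def by blast
    moreover have "\<not> m < n" using 2 step.IH mb(1) unfolding lower_def by blast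
    ultimately have mn: "m = n" by simp
    have "b - c \<in> cube d (40 * Q n)"
      by (rule cube_triangle[OF cube_sym[OF in_ball[OF mb(2)]] 1])
        (use Q_bounds(2)[of n] mn in simp)
    then have "b = c" using centres_apart mb(1) nc(1) mn by blast
    then show ?case using mb mn by blast
  next
    case base
    then show ?case using nc by blast
  qed
  then have "{w. (v, w) \<in> (link d r core)\<^sup>*} \<subseteq> {w. w - c \<in> cube d (8 * Q n - r)}" by blast
  then show "finite {w. (v, w) \<in> (link d r core)\<^sup>*}" using finite_translate_cube finite_subset by blast
qed

text \<open>In units of \<open>Q n\<close>, the start is within 5 of the centre and a path through
  smaller balls adds at most 2. One more step still ends in the inner part of radius
  \<open>8 * Q n - r\<close>, because \<open>2 * r \<le> Q n\<close>. A point there that is not core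
  lies in a ball of smaller scale, so the path stays in \<open>lower n\<close>.\<close>

lemma finite_components_shells:
  assumes deep: "\<And>v. v \<in> lattice d \<Longrightarrow> \<exists>n. \<exists>c\<in>C n. v - c \<in> cube d (5 * Q n)"
  shows "finite_components d r (lattice d - core)"
  unfolding finite_components_def
proof
  fix v assume v: "v \<in> lattice d - core"
  then obtain n c where nc: "c \<in> C n" "v - c \<in> cube d (5 * Q n)" using deep by blast
  note Q = Q_bounds[of n] r_nonneg
  have low: "w \<in> lower n" if "w \<in> lattice d - core" "w - c \<in> cube d (8 * Q n - r)" for w
    using that nc(1) unfolding core_def by blast
  have "(v, w) \<in> (link d r (lower n))\<^sup>* \<and> w \<in> lower n"
    if "(v, w) \<in> (link d r (lattice d - core))\<^sup>*" for w
    using that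
  proof (induction rule: rtrancl_induct)
    case base
    have "v - c \<in> cube d (8 * Q n - r)" using nc(2) by (rule cube_mono) (use Q in linarith)
    then show ?case using low v by blast
  next
    case (step w w')
    then have w': "w' \<in> lattice d - core" "w' - w \<in> cube d r" by (auto simp: link_def)
    have "w - v \<in> cube d (2 * Q n)" using lower_components_bounded step.IH by blast
    then have "w - c \<in> cube d (7 * Q n)" by (rule cube_triangle[OF _ nc(2)]) simp
    then have "w' - c \<in> cube d (8 * Q n - r)"
      by (rule cube_triangle[OF w'(2)]) (use Q in linarith)
    then have "w' \<in> lower n" using low w' by blast
    moreover from this have "(w, w') \<in> link d r (lower n)" using step.IH w' by (simp add: link_def)
    ultimately show ?case using step.IH by (auto intro: rtrancl_into_rtrancl)
  qed
  then have "{w. (v, w) \<in> (link d r (lattice d - core))\<^sup>*} \<subseteq> {w. w - v \<in> cube d (2 * Q n)}"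
    using lower_components_bounded by blast
  then show "finite {w. (v, w) \<in> (link d r (lattice d - core))\<^sup>*}"
    using finite_translate_cube finite_subset by blast
qed

end

section \<open>Markers and level functions\<close>

text \<open>A maximal independent set and a colouring of it, computed together by letting the points
  of colour 0, 1, 2 and so on decide in turn. After \<open>k\<close> rounds, 0 stands for points
  that are undecided or rejected, and \<open>Suc j\<close> for a marker of class
  \<open>j\<close>.\<close>

primrec greedy :: "('a \<Rightarrow> nat) \<Rightarrow> ('a \<Rightarrow> 'a set) \<Rightarrow> ('a \<Rightarrow> 'a set) \<Rightarrow> nat \<Rightarrow> 'a \<Rightarrow> nat" where
  "greedy c N1 N2 0 x = 0"
| "greedy c N1 N2 (Suc k) x =
    (if c x = k
     then if \<exists>y\<in>N1 x. greedy c N1 N2 k y > 0 then 0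
          else Suc (LEAST j. \<forall>y\<in>N2 x. greedy c N1 N2 k y \<noteq> Suc j)
     else greedy c N1 N2 k x)"

lemma greedy_eq: "greedy c N1 N2 k x = (if c x < k then greedy c N1 N2 (Suc (c x)) x else 0)"
  by (induction k) (auto simp: less_Suc_eq simp del: greedy.simps(2), auto)

context free_lattice_action
begin

lemma pred_act:
  assumes "Measurable.pred M P"
  shows "Measurable.pred M (\<lambda>x. P (act z x))"
  using measurable_compose[OF measurable_act assms] .

text \<open>The colour of \<open>x\<close> is the index of a test set that contains \<open>x\<close>
  but none of its finitely many translates by \<open>F\<close>. A translate of the same colour would
  lie in a set chosen to exclude it.\<close>

lemma ex_proper_colouring:
  assumes F: "finite F" "F \<subseteq> lattice d" "0 \<notin> F"
  obtains c :: "'a \<Rightarrow> nat" where "c \<in> measurable M (count_space UNIV)"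
    "\<And>x z. x \<in> space M \<Longrightarrow> z \<in> F \<Longrightarrow> c (act z x) \<noteq> c x"
proof -
  obtain W :: "nat \<Rightarrow> 'a set" where W: "\<And>n. W n \<in> sets M"
    "\<And>x Q. x \<in> space M \<Longrightarrow> finite Q \<Longrightarrow> x \<notin> Q \<Longrightarrow> \<exists>n. x \<in> W n \<and> W n \<inter> Q = {}"
    using standard_borel_base[OF standard] by blast
  define P where "P m x \<longleftrightarrow> x \<in> W m \<and> (\<forall>z\<in>F. \<not> act z x \<in> W m)" for m x
  have Wp: "Measurable.pred M (\<lambda>x. x \<in> W m)" for m using W(1) by simp
  have "Measurable.pred M (P m)" for m
    unfolding P_def using pred_act[OF Wp] Wp F(1) by (intro pred_intros_logic pred_intros_finite)
  then have meas: "(\<lambda>x. LEAST m. P m x) \<in> measurable M (count_space UNIV)"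
    by (intro measurable_Least)
  have P: "P (LEAST m. P m x) x" if x: "x \<in> space M" for x
  proof (rule LeastI_ex)
    have "x \<notin> (\<lambda>z. act z x) ` F" 
    proof
      assume "x \<in> (\<lambda>z. act z x) ` F"
      then obtain z where "z \<in> F" "act z x = x" by auto
      then show False using act_eq_self[OF x, of z] F by auto
    qed
    then show "\<exists>m. P m x" using W(2)[OF x, of "(\<lambda>z. act z x) ` F"] F(1) unfolding P_def by blast
  qed
  have "(LEAST m. P m (act z x)) \<noteq> (LEAST m. P m x)" if x: "x \<in> space M" "z \<in> F" for x z
  proof
    assume eq: "(LEAST m. P m (act z x)) = (LEAST m. P m x)"
    have "P (LEAST m. P m x) x" "P (LEAST m. P m x) (act z x)"
      using P[OF x(1)] P[OF act_closed[OF x(1)], of z, unfolded eq] by blast+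
    then show False using x(2) unfolding P_def by blast
  qed
  with meas show thesis by (rule that)
qed

text \<open>The value 0 means no marker, positive values are classes of markers. Markers within
  distance \<open>R\<close> of each other are equal, so at most \<open>21 ^ d\<close> others compete
  within distance \<open>10 * R\<close> and one of \<open>21 ^ d + 1\<close> classes is free.
  Covering expresses the maximality of the greedy choice.\<close>

lemma ex_markers:
  assumes R: "0 < R"
  obtains g :: "'a \<Rightarrow> nat" where "g \<in> measurable M (count_space UNIV)"
    "\<And>x. x \<in> space M \<Longrightarrow> g x \<le> Suc (21 ^ d)"
    "\<And>x z. x \<in> space M \<Longrightarrow> z \<in> cube d (10 * R) \<Longrightarrow> g x > 0 \<Longrightarrow> g (act z x) = g x \<Longrightarrow> z = 0"
    "\<And>x. x \<in> space M \<Longrightarrow> \<exists>z\<in>cube d R. g (act z x) > 0"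
proof -
  let ?F1 = "cube d R - {0}" and ?F2 = "cube d (10 * R) - {0}"
  have F: "finite ?F1" "finite ?F2" by (simp_all add: finite_cube)
  have F_sub: "?F1 \<subseteq> ?F2" using R by (auto intro: cube_mono)
  obtain c :: "'a \<Rightarrow> nat" where c: "c \<in> measurable M (count_space UNIV)"
    "\<And>x z. x \<in> space M \<Longrightarrow> z \<in> ?F2 \<Longrightarrow> c (act z x) \<noteq> c x"
    using ex_proper_colouring[OF F(2)] cube_lattice by blast
  define N1 where "N1 x = (\<lambda>z. act z x) ` ?F1" for x
  define N2 where "N2 x = (\<lambda>z. act z x) ` ?F2" for x
  define g where "g x = greedy c N1 N2 (Suc (c x)) x" for x
  have g_lower: "greedy c N1 N2 k x = (if c x < k then g x else 0)" for k x
    unfolding g_def by (rule greedy_eq)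
  have fresh_eq: "(\<forall>y\<in>N2 x. greedy c N1 N2 (c x) y \<noteq> Suc j) \<longleftrightarrow> (\<forall>y\<in>N2 x. c y < c x \<longrightarrow> g y \<noteq> Suc j)" for x j
    by (auto simp: g_lower)
  have g_rec: "g x = (if \<exists>y\<in>N1 x. c y < c x \<and> g y > 0 then 0
      else Suc (LEAST j. \<forall>y\<in>N2 x. c y < c x \<longrightarrow> g y \<noteq> Suc j))" for x
  proof -
    have "g x = (if \<exists>y\<in>N1 x. greedy c N1 N2 (c x) y > 0 then 0
      else Suc (LEAST j. \<forall>y\<in>N2 x. greedy c N1 N2 (c x) y \<noteq> Suc j))"
      by (simp add: g_def)
    then show ?thesis unfolding fresh_eq by (auto simp: g_lower)
  qed
  have meas: "greedy c N1 N2 k \<in> measurable M (count_space UNIV)" for k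
  proof (induction k)
    case 0
    have "greedy c N1 N2 0 = (\<lambda>x. 0)" by auto
    then show ?case by simp
  next
    case (Suc k)
    have comp: "(\<lambda>x. greedy c N1 N2 k (act z x)) \<in> measurable M (count_space UNIV)" for z
      using measurable_compose[OF measurable_act Suc] .
    have p: "Measurable.pred M (\<lambda>x. P (greedy c N1 N2 k (act z x)))" for P z
      using measurable_compose[OF comp, of P "count_space UNIV"] by simp
    have "Measurable.pred M (\<lambda>x. \<exists>z\<in>?F1. greedy c N1 N2 k (act z x) > 0)"
      using F(1) by (intro pred_intros_finite p[of "\<lambda>n. n > 0"])
    moreover have "(\<lambda>x. LEAST j. \<forall>z\<in>?F2. greedy c N1 N2 k (act z x) \<noteq> Suc j) \<in> measurable M (count_space UNIV)"
      using F(2) by (intro measurable_Least pred_intros_finite p[of "\<lambda>n. n \<noteq> Suc _"])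
    moreover have "Measurable.pred M (\<lambda>x. c x = k)" using c(1) by measurable
    moreover have "greedy c N1 N2 (Suc k) = (\<lambda>x. if c x = k
       then if \<exists>z\<in>?F1. greedy c N1 N2 k (act z x) > 0 then 0
          else Suc (LEAST j. \<forall>z\<in>?F2. greedy c N1 N2 k (act z x) \<noteq> Suc j)
       else greedy c N1 N2 k x)"
      unfolding N1_def N2_def by (rule ext) simp
    ultimately show ?case using Suc
      by (simp only:) (intro measurable_If measurable_const measurable_compose[OF _ measurable_count_space]; simp add: pred_def)
  qed
  have meas_g: "g \<in> measurable M (count_space UNIV)"
    unfolding g_def by (rule measurable_compose_countable[OF meas measurable_compose[OF c(1)]]) simp
  define used where "used x = {j. \<exists>y\<in>N2 x. c y < c x \<and> g y = Suc j}" for x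
  have used: "finite (used x) \<and> card (used x) \<le> 21 ^ d" if x: "x \<in> space M" for x
  proof -
    let ?S = "{z \<in> ?F2. g (act z x) > 0}"
    have apart: "v = w" if "v \<in> ?S" "w \<in> ?S" "v - w \<in> cube d R" for v w
    proof (rule ccontr)
      assume "v \<noteq> w"
      \<comment> \<open>Of two close candidates, the one with the larger colour decides later and is
        rejected.\<close>
      have *: "g (act v x) = 0" if "v \<in> ?S" "w \<in> ?S" "w - v \<in> ?F1" "c (act w x) < c (act v x)" for v w
      proof -
        have "act w x = act (w - v) (act v x)" using act_add[OF x, of "w - v" v] by simp
        then have "act w x \<in> N1 (act v x)" unfolding N1_def using that(3) by (rule image_eqI)
        moreover have "g (act w x) > 0" using that(2) by blast
        ultimately have "\<exists>y\<in>N1 (act v x). c y < c (act v x) \<and> g y > 0" using that(4) by blast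
        then show ?thesis by (subst g_rec) simp
      qed
      have d: "w - v \<in> ?F1" "v - w \<in> ?F1" using cube_sym[OF \<open>v - w \<in> cube d R\<close>] that(3) \<open>v \<noteq> w\<close> by auto
      have "act w x = act (w - v) (act v x)" using act_add[OF x, of "w - v" v] by simp
      then have "c (act w x) \<noteq> c (act v x)" using c(2)[of "act v x" "w - v"] d(1) F_sub x by auto
      then show False using *[of v w] *[of w v] d that(1,2) by force
    qed
    have S: "finite ?S" "card ?S \<le> 21 ^ d"
      by (rule cube_packing[OF R _ apart]; blast)+
    have "used x \<subseteq> (\<lambda>z. g (act z x) - 1) ` ?S"
    proof
      fix j assume "j \<in> used x"
      then obtain z where "z \<in> ?F2" "g (act z x) = Suc j" unfolding used_def N2_def by blast
      then show "j \<in> (\<lambda>z. g (act z x) - 1) ` ?S" by (intro image_eqI[of _ _ z]) auto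
    qed
    then have "finite (used x)" "card (used x) \<le> card ?S"
      using S(1) by (auto intro: finite_subset surj_card_le)
    then show ?thesis using S(2) by linarith
  qed
  have fresh: "\<exists>j\<le>21 ^ d. j \<notin> used x" if x: "x \<in> space M" for x
  proof (rule ccontr)
    assume "\<not> ?thesis"
    then have "{..21 ^ d} \<subseteq> used x" by auto
    then have "card {..(21 :: nat) ^ d} \<le> card (used x)" using used[OF x] by (intro card_mono) auto
    then show False using used[OF x] by simp
  qed
  have fresh_iff: "(\<forall>y\<in>N2 x. c y < c x \<longrightarrow> g y \<noteq> Suc j) \<longleftrightarrow> j \<notin> used x" for x j
    by (auto simp: used_def)
  have g_pos: "g x = Suc (LEAST j. j \<notin> used x)" if "g x > 0" for x
    using g_rec[of x] that unfolding fresh_iff by (auto split: if_splits)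
  have clash: "g y \<noteq> g x" if x: "x \<in> space M" "y \<in> N2 x" "c y < c x" "g x > 0" for x y
  proof
    assume "g y = g x"
    then have "(LEAST j. j \<notin> used x) \<in> used x"
      using x g_pos[OF x(4)] unfolding used_def by auto
    moreover have "(LEAST j. j \<notin> used x) \<notin> used x" using fresh[OF x(1)] LeastI_ex[of "\<lambda>j. j \<notin> used x"] by blast
    ultimately show False by blast
  qed
  show thesis
  proof (rule that[OF meas_g])
    fix x assume x: "x \<in> space M"
    show "g x \<le> Suc (21 ^ d)"
    proof (cases "g x > 0")
      case True
      obtain j where "j \<le> 21 ^ d" "j \<notin> used x" using fresh[OF x] by blast
      then show ?thesis using g_pos[OF True] using Least_le[of "\<lambda>j. j \<notin> used x" j] by simp
    qed simp
    show "\<exists>z\<in>cube d R. g (act z x) > 0"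
    proof (cases "g x > 0")
      case True
      then show ?thesis using R by (intro bexI[of _ 0]) auto
    next
      case False
      then obtain y where "y \<in> N1 x" "g y > 0" using g_rec[of x] by (auto split: if_splits)
      then show ?thesis unfolding N1_def by blast
    qed
  next
    fix x z assume x: "x \<in> space M" "z \<in> cube d (10 * R)" "g x > 0" "g (act z x) = g x"
    show "z = 0"
    proof (rule ccontr)
      assume "z \<noteq> 0"
      then have z: "z \<in> ?F2" "- z \<in> ?F2" using x(2) cube_uminus by auto
      have "act z x \<in> N2 x" unfolding N2_def using z by blast
      moreover have "x \<in> N2 (act z x)"
        unfolding N2_def using z act_uminus(1)[OF x(1), of z] by (intro image_eqI[of _ _ "- z"]) auto
      moreover have "c (act z x) \<noteq> c x" using c(2) x(1) z by blast
      ultimately show False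
        using clash[of x "act z x"] clash[of "act z x" x] x by fastforce
    qed
  qed
qed

end

section \<open>A Borel set with finite components on both sides\<close>

context free_lattice_action
begin

definition visits :: "'a set \<Rightarrow> 'a \<Rightarrow> (nat \<Rightarrow> int) set" where
  "visits E x = {z \<in> lattice d. act z x \<in> E}"

lemma pred_Bex_cube:
  "(\<And>z. z \<in> cube d r \<Longrightarrow> Measurable.pred M (P z)) \<Longrightarrow> Measurable.pred M (\<lambda>x. \<exists>z\<in>cube d r. P z x)"
  by (intro pred_intros_finite finite_cube)

lemma pred_Ball_cube:
  "(\<And>z. z \<in> cube d r \<Longrightarrow> Measurable.pred M (P z)) \<Longrightarrow> Measurable.pred M (\<lambda>x. \<forall>z\<in>cube d r. P z x)"
  by (intro pred_intros_finite finite_cube)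

text \<open>Each colour class of a marker set of large scale is sparse, but covers only a part of
  the space. By the pigeonhole principle every point is covered infinitely often by the
  classes of one colour, and the set of points where this happens for a given colour
  is invariant.\<close>

lemma ex_two_sided_finite_components:
  assumes r: "0 < r"
  obtains B where "B \<in> sets M"
    "\<And>x. x \<in> space M \<Longrightarrow> finite_components d r (visits B x)"
    "\<And>x. x \<in> space M \<Longrightarrow> finite_components d r (visits (space M - B) x)"
proof -
  \<comment> \<open>With markers of radius \<open>4 * Q n\<close>, the tenfold separation inside a
    class is the \<open>40 * Q n\<close> demanded of centres, and the covering radius stays below
    the \<open>5 * Q n\<close> needed for the shells.\<close>
  define Q where "Q n = 2 * r * 16 ^ n" for n :: nat
  have Q0: "0 < Q n" for n using r by (simp add: Q_def)
  have Q_ge: "int n \<le> Q n" for n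
  proof (induction n)
    case (Suc n)
    have "Q (Suc n) = 16 * Q n" by (simp add: Q_def)
    then show ?case using Suc Q0[of n] by simp
  qed (use r in \<open>simp add: Q_def\<close>)
  have "\<forall>n. \<exists>g :: 'a \<Rightarrow> nat. g \<in> measurable M (count_space UNIV) \<and>
    (\<forall>x\<in>space M. g x \<le> Suc (21 ^ d)) \<and>
    (\<forall>x\<in>space M. \<forall>z\<in>cube d (10 * (4 * Q n)). g x > 0 \<longrightarrow> g (act z x) = g x \<longrightarrow> z = 0) \<and>
    (\<forall>x\<in>space M. \<exists>z\<in>cube d (4 * Q n). g (act z x) > 0)"
  proof
    fix n
    have pos: "0 < 4 * Q n" using Q0[of n] by simp
    show "\<exists>g :: 'a \<Rightarrow> nat. g \<in> measurable M (count_space UNIV) \<and>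
      (\<forall>x\<in>space M. g x \<le> Suc (21 ^ d)) \<and>
      (\<forall>x\<in>space M. \<forall>z\<in>cube d (10 * (4 * Q n)). g x > 0 \<longrightarrow> g (act z x) = g x \<longrightarrow> z = 0) \<and>
      (\<forall>x\<in>space M. \<exists>z\<in>cube d (4 * Q n). g (act z x) > 0)"
      by (rule ex_markers[OF pos], rule exI, intro conjI ballI impI) (assumption | blast)+
  qed
  then obtain g :: "nat \<Rightarrow> 'a \<Rightarrow> nat" where
    g: "\<forall>n. g n \<in> measurable M (count_space UNIV) \<and>
    (\<forall>x\<in>space M. g n x \<le> Suc (21 ^ d)) \<and>
    (\<forall>x\<in>space M. \<forall>z\<in>cube d (10 * (4 * Q n)). g n x > 0 \<longrightarrow> g n (act z x) = g n x \<longrightarrow> z = 0) \<and>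
    (\<forall>x\<in>space M. \<exists>z\<in>cube d (4 * Q n). g n (act z x) > 0)"
    by (rule choice[THEN exE])
  have g_meas: "g n \<in> measurable M (count_space UNIV)" for n
    using g[THEN spec, of n, THEN conjunct1] .
  have g_le: "g n x \<le> Suc (21 ^ d)" if "x \<in> space M" for n x
    using g[THEN spec, of n, THEN conjunct2, THEN conjunct1, THEN bspec, OF that] .
  have g_apart: "z = 0" if "x \<in> space M" "z \<in> cube d (40 * Q n)" "g n x > 0" "g n (act z x) = g n x" for n x z
  proof -
    have "z \<in> cube d (10 * (4 * Q n))" using that(2) by simp
    then show ?thesis
      using g[THEN spec, of n, THEN conjunct2, THEN conjunct2, THEN conjunct1, THEN bspec, OF that(1)]
        that(3,4) by blast
  qed
  have g_cover: "\<exists>z\<in>cube d (4 * Q n). g n (act z x) > 0" if "x \<in> space M" for n x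
    using g[THEN spec, of n, THEN conjunct2, THEN conjunct2, THEN conjunct2, THEN bspec, OF that] .
  have pg: "Measurable.pred M (\<lambda>x. g n (act z x) = k)" for n z k
  proof (rule pred_act)
    show "Measurable.pred M (\<lambda>x. g n x = k)" using g_meas[of n] by measurable
  qed
  \<comment> \<open>The additive slack \<open>t\<close> makes the condition invariant under the
    action. For large \<open>n\<close> it is absorbed by \<open>Q n\<close>, which turns the radius
    \<open>4 * Q n\<close> into at most \<open>5 * Q n\<close>.\<close>
  define Y where "Y i x \<longleftrightarrow> (\<exists>t. \<forall>n0. \<exists>n\<ge>n0. \<exists>z\<in>cube d (4 * Q n + int t). g n (act z x) = Suc i)" for i x
  have Y_act: "Y i (act w x)" if xw: "x \<in> space M" "w \<in> lattice d" "Y i x" for i w x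
  proof -
    obtain s where s: "w \<in> cube d (int s)"
    proof
      show "w \<in> cube d (int (\<Sum>i<d. nat \<bar>w i\<bar>))"
      proof -
        have "\<bar>w i\<bar> \<le> int (\<Sum>i<d. nat \<bar>w i\<bar>)" if "i < d" for i
        proof -
          have "nat \<bar>w i\<bar> \<le> (\<Sum>i<d. nat \<bar>w i\<bar>)" using that by (intro member_le_sum) auto
          then show ?thesis by linarith
        qed
        then show ?thesis using xw(2) by (simp add: cube_def)
      qed
    qed
    obtain t where t: "\<forall>n0. \<exists>n\<ge>n0. \<exists>z\<in>cube d (4 * Q n + int t). g n (act z x) = Suc i"
      using \<open>Y i x\<close> unfolding Y_def by blast
    have "\<exists>n\<ge>n0. \<exists>z\<in>cube d (4 * Q n + int (t + s)). g n (act z (act w x)) = Suc i" for n0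
    proof -
      obtain n z where nz: "n \<ge> n0" "z \<in> cube d (4 * Q n + int t)" "g n (act z x) = Suc i" using t by blast
      have "act (z - w) (act w x) = act z x" using act_add[OF xw(1), of "z - w" w] by simp
      moreover have "z - w \<in> cube d (4 * Q n + int (t + s))"
        using cube_add[OF nz(2) cube_uminus[OF s]] by (simp add: add_ac)
      ultimately show ?thesis using nz by metis
    qed
    then show ?thesis unfolding Y_def by blast
  qed
  have Y_act_iff: "Y i (act w x) \<longleftrightarrow> Y i x" if "x \<in> space M" "w \<in> lattice d" for i w x
    using Y_act[OF that] Y_act[of "act w x" "- w"] that by (auto simp: act_uminus lattice_uminus)
  have ex_Y: "\<exists>i. Y i x" if x: "x \<in> space M" for x
  proof -
    have "\<forall>n. \<exists>i. \<exists>z\<in>cube d (4 * Q n). g n (act z x) = Suc i"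
      using g_cover[OF x] gr0_implies_Suc by blast
    then obtain i where i: "\<forall>n. \<exists>z\<in>cube d (4 * Q n). g n (act z x) = Suc (i n)" by (rule choice[THEN exE])
    have "i n \<le> 21 ^ d" for n
    proof -
      obtain z where "g n (act z x) = Suc (i n)" using i by blast
      then show ?thesis using g_le[OF act_closed[OF x], of n z] by simp
    qed
    then have "finite (range i)" by (intro finite_subset[of "range i" "{..21 ^ d}"]) auto
    then obtain n0 where "infinite {n. i n = i n0}" using pigeonhole_infinite[of UNIV i] by auto
    then have "\<forall>m. \<exists>n\<ge>m. i n = i n0" by (simp add: infinite_nat_iff_unbounded_le)
    then have "Y (i n0) x" unfolding Y_def using i by (intro exI[of _ 0]) (metis add_0_right of_nat_0)
    then show ?thesis ..
  qed
  \<comment> \<open>An invariant choice, so that all points of an orbit use balls of the same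
    class.\<close>
  define j where "j x = (LEAST i. Y i x)" for x
  have Yj: "Y (j x) x" if "x \<in> space M" for x
    unfolding j_def using ex_Y[OF that] by (rule LeastI_ex)
  have j_act: "j (act w x) = j x" if "x \<in> space M" "w \<in> lattice d" for w x
    unfolding j_def using Y_act_iff[OF that] by simp
  have "Measurable.pred M (Y i)" for i
    unfolding Y_def by (intro pred_intros_countable pred_intros_logic pred_Bex_cube pg) simp
  then have j_meas: "j \<in> measurable M (count_space UNIV)"
    unfolding j_def by (intro measurable_Least)
  \<comment> \<open>The points whose origin is core for the centres of class \<open>i\<close>,
    written with quantifiers over finite or countable sets.\<close>
  define A where "A i = {x \<in> space M. \<exists>n. \<exists>z\<in>cube d (8 * Q n - r). g n (act z x) = Suc i \<and>
    (\<forall>m<n. \<forall>z\<in>cube d (8 * Q m). g m (act z x) \<noteq> Suc i)}" for i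
  define B where "B = {x \<in> space M. x \<notin> A (j x)}"
  have A_pred: "Measurable.pred M (\<lambda>x. x \<notin> A i)" for i
  proof -
    have "Measurable.pred M (\<lambda>x. \<exists>n. \<exists>z\<in>cube d (8 * Q n - r). g n (act z x) = Suc i \<and>
      (\<forall>m<n. \<forall>z\<in>cube d (8 * Q m). g m (act z x) \<noteq> Suc i))"
      by (intro pred_intros_countable pred_intros_logic pred_Bex_cube pred_Ball_cube pg) simp_all
    then have "A i \<in> sets M" unfolding A_def pred_def .
    then show ?thesis by measurable
  qed
  have "Measurable.pred M (\<lambda>x. x \<notin> A (j x))"
    using measurable_compose_countable[of "\<lambda>i x. x \<notin> A i", OF A_pred j_meas] .
  then have B_sets: "B \<in> sets M" unfolding B_def pred_def .
  have comps: "finite_components d r (visits B x) \<and> finite_components d r (visits (space M - B) x)"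
    if x: "x \<in> space M" for x
  proof -
    define C where "C n = {z \<in> lattice d. g n (act z x) = Suc (j x)}" for n
    interpret scaled_balls d r Q C
    proof
      show "0 \<le> r" "2 * r \<le> Q 0" "16 * Q n \<le> Q (Suc n)" for n using r by (simp_all add: Q_def)
      fix b n c assume bc: "b \<in> C n" "c \<in> C n" "b - c \<in> cube d (40 * Q n)"
      have "act b x = act (b - c) (act c x)" using act_add[OF x, of "b - c" c] by simp
      then have "b - c = 0" using bc by (intro g_apart[of "act c x" _ n]) (auto simp: C_def x)
      then show "b = c" by simp
    qed
    have near: "(\<exists>z\<in>cube d s. g n (act z (act v x)) = Suc (j x)) \<longleftrightarrow> (\<exists>c\<in>C n. v - c \<in> cube d s)"
      if v: "v \<in> lattice d" for v s n
    proof
      assume "\<exists>z\<in>cube d s. g n (act z (act v x)) = Suc (j x)"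
      then obtain z where z: "z \<in> cube d s" "g n (act z (act v x)) = Suc (j x)" by blast
      then have "z + v \<in> C n" using v by (simp add: C_def act_add[OF x] lattice_add cube_lattice)
      moreover have "v - (z + v) \<in> cube d s" using cube_uminus[OF z(1)] by simp
      ultimately show "\<exists>c\<in>C n. v - c \<in> cube d s" by blast
    next
      assume "\<exists>c\<in>C n. v - c \<in> cube d s"
      then obtain c where c: "c \<in> C n" "v - c \<in> cube d s" by blast
      have "act (c - v) (act v x) = act c x" using act_add[OF x, of "c - v" v] by simp
      then show "\<exists>z\<in>cube d s. g n (act z (act v x)) = Suc (j x)"
        using c cube_sym[OF c(2)] by (intro bexI[of _ "c - v"]) (auto simp: C_def)
    qed
    have in_A: "act v x \<in> A (j x) \<longleftrightarrow> v \<in> core" if v: "v \<in> lattice d" for v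
    proof -
      have low: "(\<forall>m<n. \<forall>z\<in>cube d (8 * Q m). g m (act z (act v x)) \<noteq> Suc (j x)) \<longleftrightarrow> v \<notin> lower n" for n
        using near[OF v] unfolding lower_def by blast
      show ?thesis
        unfolding A_def core_def mem_Collect_eq low
        using near[OF v] act_closed[OF x, of v] v by blast
    qed
    have "core \<subseteq> lattice d" by (auto simp: core_def)
    then have v1: "visits (space M - B) x = core"
      using in_A j_act[OF x] act_closed[OF x] unfolding visits_def B_def by auto
    have v2: "visits B x = lattice d - core"
      using in_A j_act[OF x] act_closed[OF x] unfolding visits_def B_def by auto
    have "finite_components d r (lattice d - core)"
    proof (rule finite_components_shells)
      fix v assume v: "v \<in> lattice d"
      have "Y (j x) (act v x)" using Yj[OF x] Y_act_iff[OF x v] by blast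
      then obtain t n z where tnz: "n \<ge> t" "z \<in> cube d (4 * Q n + int t)" "g n (act z (act v x)) = Suc (j x)"
        unfolding Y_def by blast
      have "z \<in> cube d (5 * Q n)" using tnz(2) by (rule cube_mono) (use Q_ge[of n] tnz(1) in linarith)
      then show "\<exists>n. \<exists>c\<in>C n. v - c \<in> cube d (5 * Q n)" using near[OF v] tnz(3) by blast
    qed
    then show ?thesis using v1 v2 finite_components_core by simp
  qed
  show thesis by (rule that[OF B_sets]) (use comps in blast)+
qed

end

text \<open>Consecutive points of the thickened set differ by at most 1, and each is within
  \<open>a\<close> of a point of \<open>P\<close>; these points of \<open>P\<close> are within
  \<open>a + 1 + a\<close> of each other.\<close>

lemma finite_components_thicken:
  assumes fin: "finite_components d (2 * a + 1) P"
  shows "finite_components d 1 {v. \<exists>b\<in>P. v - b \<in> cube d a}"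
  unfolding finite_components_def
proof
  let ?N = "{v. \<exists>b\<in>P. v - b \<in> cube d a}"
  fix v assume "v \<in> ?N"
  then obtain b where b: "b \<in> P" "v - b \<in> cube d a" by blast
  let ?K = "{c. (b, c) \<in> (link d (2 * a + 1) P)\<^sup>*}"
  have "\<exists>c\<in>P. w - c \<in> cube d a \<and> c \<in> ?K" if "(v, w) \<in> (link d 1 ?N)\<^sup>*" for w
    using that
  proof (induction rule: rtrancl_induct)
    case base
    then show ?case using b by blast
  next
    case (step w w')
    then obtain c where c: "c \<in> P" "w - c \<in> cube d a" "c \<in> ?K" by blast
    have w': "w' \<in> ?N" "w' - w \<in> cube d 1" using step.hyps(2) by (simp_all add: link_def)
    then obtain c' where c': "c' \<in> P" "w' - c' \<in> cube d a" by blast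
    have "c' - w \<in> cube d (a + 1)"
      by (rule cube_triangle[OF cube_sym[OF c'(2)] w'(2)]) simp
    then have "c' - c \<in> cube d (2 * a + 1)"
      by (rule cube_triangle[OF _ c(2)]) simp
    then have "(c, c') \<in> link d (2 * a + 1) P" using c(1) c'(1) by (simp add: link_def)
    then have "c' \<in> ?K" using c(3) by (simp add: rtrancl_into_rtrancl)
    then show ?case using c' by blast
  qed
  then have "{w. (v, w) \<in> (link d 1 ?N)\<^sup>*} \<subseteq> (\<Union>c\<in>?K. {w. w - c \<in> cube d a})" by blast
  moreover have "finite ?K" using fin b(1) unfolding finite_components_def by blast
  ultimately show "finite {w. (v, w) \<in> (link d 1 ?N)\<^sup>*}"
    by (rule finite_subset[OF _ finite_UN_I]) (rule finite_translate_cube)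
qed

lemma link_translate:
  assumes "\<And>z. z \<in> P' \<Longrightarrow> z + e \<in> P" "(v, w) \<in> (link d r P')\<^sup>*"
  shows "(v + e, w + e) \<in> (link d r P)\<^sup>*"
  using assms(2)
proof (induction rule: rtrancl_induct)
  case (step w w')
  then have w: "w \<in> P'" "w' \<in> P'" "w' - w \<in> cube d r" by (simp_all add: link_def)
  have "(w' + e) - (w + e) = w' - w" by simp
  then have "(w' + e) - (w + e) \<in> cube d r" using w(3) by (simp only:)
  then have "(w + e, w' + e) \<in> link d r P"
    unfolding link_def using assms(1) w(1,2) by blast
  with step.IH show ?case by (rule rtrancl_into_rtrancl)
qed (rule rtrancl_refl)

lemma axis_vec_cube: "i < d \<Longrightarrow> axis_vec i 1 \<in> cube d 1"
  by (auto simp: cube_def axis_vec_lattice) (simp add: axis_vec_def)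

section \<open>Level functions and parities\<close>

context free_lattice_action
begin

text \<open>Take the distance to a set \<open>B\<close> with finite components on both sides, cut
  off at \<open>N\<close>. A sublevel set lies in the \<open>a\<close>-neighbourhood of
  \<open>B\<close>, which is why jumps of size \<open>2 * N + 1\<close> are allowed for
  \<open>B\<close>. A superlevel set misses \<open>B\<close> because
  \<open>0 \<le> a\<close>.\<close>

lemma ex_level_function:
  fixes N :: nat
  obtains \<delta> :: "'a \<Rightarrow> int" where "\<delta> \<in> measurable M (count_space UNIV)"
    "\<And>x i. x \<in> space M \<Longrightarrow> i < d \<Longrightarrow> \<bar>\<delta> (\<phi> i x) - \<delta> x\<bar> \<le> 1"
    "\<And>a x. x \<in> space M \<Longrightarrow> 0 \<le> a \<Longrightarrow> a < int N \<Longrightarrow>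
       finite_components d 1 (visits {y \<in> space M. \<delta> y \<le> a} x)"
    "\<And>a x. x \<in> space M \<Longrightarrow> 0 \<le> a \<Longrightarrow> a < int N \<Longrightarrow>
       finite_components d 1 (visits {y \<in> space M. a < \<delta> y} x)"
proof -
  have r: "0 < 2 * int N + 1" by simp
  obtain B where B: "B \<in> sets M"
    "\<And>x. x \<in> space M \<Longrightarrow> finite_components d (2 * int N + 1) (visits B x)"
    "\<And>x. x \<in> space M \<Longrightarrow> finite_components d (2 * int N + 1) (visits (space M - B) x)"
    using ex_two_sided_finite_components[OF r] by blast
  define near where "near s x \<longleftrightarrow> (\<exists>z\<in>cube d (int s). act z x \<in> B)" for s x
  define \<delta> where "\<delta> x = (LEAST s. N \<le> s \<or> near s x)" for x
  have near_mono: "near s x \<Longrightarrow> s \<le> t \<Longrightarrow> near t x" for s t x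
    unfolding near_def by (meson cube_mono of_nat_mono)
  have \<delta>: "N \<le> \<delta> x \<or> near (\<delta> x) x" for x
    unfolding \<delta>_def by (rule LeastI[of _ N]) simp
  have \<delta>_le: "\<delta> x \<le> a \<longleftrightarrow> near a x" if "a < N" for a x
  proof
    assume "\<delta> x \<le> a"
    then show "near a x" using \<delta>[of x] near_mono[of "\<delta> x" x a] that by auto
  next
    assume "near a x"
    then show "\<delta> x \<le> a" unfolding \<delta>_def by (intro Least_le) simp
  qed
  have \<delta>_N: "\<delta> x \<le> N" for x unfolding \<delta>_def by (rule Least_le) simp
  have near_step: "near (Suc s) (act e x)" if x: "x \<in> space M" and e: "e \<in> cube d 1" and n: "near s x" for s e x
  proof -
    obtain z where z: "z \<in> cube d (int s)" "act z x \<in> B" using n unfolding near_def by blast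
    have "act (z - e) (act e x) \<in> B" using z(2) act_add[OF x, of "z - e" e] by simp
    moreover have "z - e \<in> cube d (int (Suc s))"
      using cube_add[OF z(1) cube_uminus[OF e]] by (simp add: add_ac)
    ultimately show ?thesis unfolding near_def by blast
  qed
  have \<delta>_step: "\<delta> (act e x) \<le> Suc (\<delta> x)" if x: "x \<in> space M" and e: "e \<in> cube d 1" for e x
  proof (cases "\<delta> x < N")
    case True
    then have "near (Suc (\<delta> x)) (act e x)" using \<delta>[of x] near_step[OF x e] by auto
    then show ?thesis unfolding \<delta>_def[of "act e x"] by (intro Least_le) simp
  next
    case False
    then show ?thesis using \<delta>_N[of "act e x"] by simp
  qed
  have B_pred: "Measurable.pred M (\<lambda>x. x \<in> B)" using B(1) by simp
  show thesis
  proof (rule that[of "\<lambda>x. int (\<delta> x)"])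
    have "\<delta> \<in> measurable M (count_space UNIV)"
      unfolding \<delta>_def near_def
      by (intro measurable_Least pred_intros_logic pred_Bex_cube pred_act[OF B_pred]) simp
    then show "(\<lambda>x. int (\<delta> x)) \<in> measurable M (count_space UNIV)" by measurable
  next
    fix x i assume x: "x \<in> space M" "i < d"
    have "\<delta> (\<phi> i x) \<le> Suc (\<delta> x)"
      using \<delta>_step[OF x(1) axis_vec_cube[OF x(2)]] x by (simp add: act_axis_vec_one)
    moreover have "act (- axis_vec i 1) (\<phi> i x) = x"
      using act_uminus(1)[OF x(1), of "axis_vec i 1"] x(2) by (simp only: act_axis_vec_one)
    then have "\<delta> x \<le> Suc (\<delta> (\<phi> i x))"
      using \<delta>_step[of "\<phi> i x" "- axis_vec i 1"] cube_uminus[OF axis_vec_cube[OF x(2)]] x by simp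
    ultimately show "\<bar>int (\<delta> (\<phi> i x)) - int (\<delta> x)\<bar> \<le> 1" by linarith
  next
    fix a x assume x: "x \<in> space M" and a: "0 \<le> a" "a < int N"
    have le: "int (\<delta> y) \<le> a \<longleftrightarrow> near (nat a) y" for y
      using \<delta>_le[of "nat a" y] a by linarith
    have "visits {y \<in> space M. int (\<delta> y) \<le> a} x \<subseteq> {v. \<exists>b\<in>visits B x. v - b \<in> cube d a}"
    proof
      fix v assume "v \<in> visits {y \<in> space M. int (\<delta> y) \<le> a} x"
      then have v: "v \<in> lattice d" "near (nat a) (act v x)" unfolding le by (auto simp: visits_def)
      then obtain z where z: "z \<in> cube d a" "act z (act v x) \<in> B"
        using a unfolding near_def by auto
      have "z + v \<in> visits B x"
        using z v by (simp add: visits_def act_add[OF x] lattice_add cube_lattice)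
      moreover have "v - (z + v) \<in> cube d a" using cube_uminus[OF z(1)] by simp
      ultimately show "v \<in> {v. \<exists>b\<in>visits B x. v - b \<in> cube d a}" by blast
    qed
    moreover have "finite_components d (2 * a + 1) (visits B x)"
      using B(2)[OF x] by (rule finite_components_subset) (use a in auto)
    ultimately show "finite_components d 1 (visits {y \<in> space M. int (\<delta> y) \<le> a} x)"
      using finite_components_thicken finite_components_subset by blast
    have "visits {y \<in> space M. a < int (\<delta> y)} x \<subseteq> visits (space M - B) x"
    proof
      fix v assume "v \<in> visits {y \<in> space M. a < int (\<delta> y)} x"
      then have v: "v \<in> lattice d" "\<not> near (nat a) (act v x)" using le[of "act v x"] by (auto simp: visits_def)
      have "act v x \<notin> B"
      proof
        assume "act v x \<in> B"
        then have "near (nat a) (act v x)" unfolding near_def by (intro bexI[of _ 0]) auto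
        then show False using v by blast
      qed
      then show "v \<in> visits (space M - B) x" using v x by (simp add: visits_def)
    qed
    then show "finite_components d 1 (visits {y \<in> space M. a < int (\<delta> y)} x)"
      using B(3)[OF x] a by (rule_tac finite_components_subset) auto
  qed
qed

lemma pred_visits_connected:
  assumes E: "E \<in> sets M"
  shows "Measurable.pred M (\<lambda>x. (0, w) \<in> (link d r (visits E x))\<^sup>*)"
proof -
  have E_pred: "Measurable.pred M (\<lambda>x. x \<in> E)" using E by simp
  have link: "(v, w) \<in> link d r (visits E x) \<longleftrightarrow>
    (v \<in> lattice d \<and> w \<in> lattice d \<and> w - v \<in> cube d r) \<and> act v x \<in> E \<and> act w x \<in> E" for v w x
    by (auto simp: link_def visits_def)
  have "Measurable.pred M (\<lambda>x. (0, w) \<in> link d r (visits E x) ^^ n)" for n w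
  proof (induction n arbitrary: w)
    case 0
    then show ?case by simp
  next
    case (Suc n)
    have "(0, w) \<in> link d r (visits E x) ^^ Suc n \<longleftrightarrow>
      (\<exists>v\<in>lattice d. (0, v) \<in> link d r (visits E x) ^^ n \<and> (v, w) \<in> link d r (visits E x))" for x
      by (auto simp: link)
    then show ?case
      by (simp only:) (intro pred_Bex_countable countable_lattice pred_intros_logic Suc,
          unfold link, intro pred_intros_logic pred_act[OF E_pred], simp_all)
  qed
  then show ?thesis unfolding rtrancl_power by (intro pred_intros_countable)
qed

text \<open>Parities are read off from the position relative to the least coordinate in the component.\<close>

lemma ex_parity:
  assumes E: "E \<in> sets M" "\<And>x. x \<in> space M \<Longrightarrow> finite_components d 1 (visits E x)"
  obtains q :: "'a \<Rightarrow> bool" where "Measurable.pred M q"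
    "\<And>x l. x \<in> space M \<Longrightarrow> x \<in> E \<Longrightarrow> l < d \<Longrightarrow> \<phi> l x \<in> E \<Longrightarrow> q (\<phi> l x) \<longleftrightarrow> q x \<noteq> (l = i)"
proof -
  \<comment> \<open>The \<open>i\<close>-coordinates of \<open>x\<close> relative to the points of
    its component, so that the maximum is the height of \<open>x\<close> above the lowest point. In
    \<open>q\<close> this maximum is expressed by quantifiers over the integers to keep
    measurability evident.\<close>
  define S where "S x = {k. \<exists>w\<in>lattice d. - w i = k \<and> (0, w) \<in> (link d 1 (visits E x))\<^sup>*}" for x
  define q where "q x \<longleftrightarrow> (\<exists>m. even m \<and> m \<in> S x \<and> (\<forall>k. k \<in> S x \<longrightarrow> k \<le> m))" for x
  have "Measurable.pred M (\<lambda>x. k \<in> S x)" for k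
    unfolding S_def mem_Collect_eq
    by (intro pred_Bex_countable countable_lattice pred_intros_logic pred_visits_connected E) simp
  then have meas: "Measurable.pred M q"
    unfolding q_def by (intro pred_intros_countable pred_intros_logic) auto
  have S_step: "S (\<phi> l x) = (\<lambda>k. k + (if l = i then 1 else 0)) ` S x"
    if x: "x \<in> space M" "x \<in> E" "l < d" "\<phi> l x \<in> E" for x l
  proof -
    let ?e = "axis_vec l 1" and ?L = "link d 1 (visits E x)" and ?L' = "link d 1 (visits E (\<phi> l x))"
    have e: "?e \<in> lattice d" using x by (simp add: axis_vec_lattice)
    have act_e: "act z (\<phi> l x) = act (z + ?e) x" for z
      using x act_add[of x z ?e] by (simp add: act_axis_vec_one)
    have shift: "z \<in> visits E (\<phi> l x) \<Longrightarrow> z + ?e \<in> visits E x" for z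
      using e by (simp add: visits_def act_e lattice_add)
    have shift': "z \<in> visits E x \<Longrightarrow> z + (- ?e) \<in> visits E (\<phi> l x)" for z
      using e lattice_diff[of z d ?e] by (simp add: visits_def act_e)
    have "0 \<in> visits E x" "?e \<in> visits E x"
      using x e by (simp_all add: visits_def act_axis_vec_one)
    moreover have "?e - 0 \<in> cube d 1" "0 - ?e \<in> cube d 1"
      using axis_vec_cube[OF x(3)] cube_uminus by simp_all
    ultimately have L: "(0, ?e) \<in> ?L" "(?e, 0) \<in> ?L" unfolding link_def by blast+
    have conn: "(0, w) \<in> ?L'\<^sup>* \<longleftrightarrow> (0, w + ?e) \<in> ?L\<^sup>*" for w
    proof
      assume "(0, w) \<in> ?L'\<^sup>*"
      then have "(0 + ?e, w + ?e) \<in> ?L\<^sup>*" by (rule link_translate[where P' = "visits E (\<phi> l x)", rotated]) (rule shift)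
      then have "(?e, w + ?e) \<in> ?L\<^sup>*" by (simp only: add_0_left)
      with L(1) show "(0, w + ?e) \<in> ?L\<^sup>*" by (rule converse_rtrancl_into_rtrancl)
    next
      assume "(0, w + ?e) \<in> ?L\<^sup>*"
      with L(2) have "(?e, w + ?e) \<in> ?L\<^sup>*" by (rule converse_rtrancl_into_rtrancl)
      then have "(?e + (- ?e), w + ?e + (- ?e)) \<in> ?L'\<^sup>*" by (rule link_translate[where P' = "visits E x", rotated]) (rule shift')
      then show "(0, w) \<in> ?L'\<^sup>*" by (simp only: add_minus_cancel add.right_inverse add.assoc add_0_right)
    qed
    show ?thesis
    proof (intro equalityI subsetI)
      fix k assume "k \<in> S (\<phi> l x)"
      then obtain w where w: "w \<in> lattice d" "- w i = k" "(0, w) \<in> ?L'\<^sup>*" unfolding S_def by blast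
      have "- (w + ?e) i \<in> S x" unfolding S_def using w conn e lattice_add by blast
      then show "k \<in> (\<lambda>k. k + (if l = i then 1 else 0)) ` S x"
        using w(2) by (intro image_eqI[of _ _ "- (w + ?e) i"]) (auto simp: axis_vec_def)
    next
      fix k assume "k \<in> (\<lambda>k. k + (if l = i then 1 else 0)) ` S x"
      then obtain w where w: "w \<in> lattice d" "k = - w i + (if l = i then 1 else 0)" "(0, w) \<in> ?L\<^sup>*"
        unfolding S_def by blast
      have "w - ?e + ?e = w" by simp
      then have "(0, w - ?e) \<in> ?L'\<^sup>*" using conn[of "w - ?e"] w(3) by (simp only:)
      then have "- (w - ?e) i \<in> S (\<phi> l x)" unfolding S_def using w(1) e lattice_diff by blast
      moreover have "- (w - ?e) i = k" using w(2) by (auto simp: axis_vec_def)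
      ultimately show "k \<in> S (\<phi> l x)" by simp
    qed
  qed
  have S_max: "\<exists>m\<in>S x. \<forall>k\<in>S x. k \<le> m" if x: "x \<in> space M" "x \<in> E" for x
  proof -
    have "0 \<in> visits E x" using x by (simp add: visits_def)
    then have "finite {w. (0, w) \<in> (link d 1 (visits E x))\<^sup>*}"
      using E(2)[OF x(1)] unfolding finite_components_def by blast
    then have "finite ((\<lambda>w. - w i) ` {w. (0, w) \<in> (link d 1 (visits E x))\<^sup>*})" by (rule finite_imageI)
    then have fin: "finite (S x)" by (rule finite_subset[rotated]) (auto simp: S_def)
    have "0 \<in> S x" unfolding S_def mem_Collect_eq by (intro bexI[of _ 0]) auto
    then show ?thesis using fin Max_in[of "S x"] Max_ge[of "S x"] by blast
  qed
  have q_max: "q x \<longleftrightarrow> even m" if "m \<in> S x" "\<forall>k\<in>S x. k \<le> m" for x m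
  proof -
    have "n = m" if "n \<in> S x" "\<forall>k. k \<in> S x \<longrightarrow> k \<le> n" for n
      using that \<open>m \<in> S x\<close> \<open>\<forall>k\<in>S x. k \<le> m\<close> by (meson order_antisym)
    then show ?thesis unfolding q_def using that by blast
  qed
  have "q (\<phi> l x) \<longleftrightarrow> q x \<noteq> (l = i)"
    if x: "x \<in> space M" "x \<in> E" "l < d" "\<phi> l x \<in> E" for x l
  proof -
    obtain m where m: "m \<in> S x" "\<forall>k\<in>S x. k \<le> m" using S_max[OF x(1,2)] by blast
    have "q (\<phi> l x) \<longleftrightarrow> even (m + (if l = i then 1 else 0))"
      by (rule q_max) (use m in \<open>auto simp: S_step[OF x]\<close>)
    then show ?thesis using q_max[OF m] by auto
  qed
  with meas show thesis by (rule that)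
qed

end

section \<open>Colouring with walls\<close>

lemma half_edges_iff [simp]: "(k, b) \<in> half_edges d \<longleftrightarrow> k < d"
  by (simp add: half_edges_def)

text \<open>The walls of direction \<open>i\<close> lie at level \<open>20 * i\<close> of \<open>\<delta>\<close>. Below this level the edges of
  direction \<open>i\<close> alternate according to \<open>qS i\<close> and above it according to \<open>qT i\<close>.\<close>

locale parity_walls = free_lattice_action +
  fixes \<delta> :: "'a \<Rightarrow> int" and qS qT :: "nat \<Rightarrow> 'a \<Rightarrow> bool"
  assumes d_gt_1: "1 < d"
    and \<delta>_generator: "x \<in> space M \<Longrightarrow> i < d \<Longrightarrow> \<bar>\<delta> (\<phi> i x) - \<delta> x\<bar> \<le> 1"
    and qS_generator: "x \<in> space M \<Longrightarrow> i < d \<Longrightarrow> l < d \<Longrightarrow> \<delta> x \<le> 20 * int i + 10 \<Longrightarrow>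
      \<delta> (\<phi> l x) \<le> 20 * int i + 10 \<Longrightarrow> qS i (\<phi> l x) \<longleftrightarrow> qS i x \<noteq> (l = i)"
    and qT_generator: "x \<in> space M \<Longrightarrow> i < d \<Longrightarrow> l < d \<Longrightarrow> 20 * int i < \<delta> x \<Longrightarrow>
      20 * int i < \<delta> (\<phi> l x) \<Longrightarrow> qT i (\<phi> l x) \<longleftrightarrow> qT i x \<noteq> (l = i)"
begin

definition rung :: "nat \<Rightarrow> nat" where "rung i = (if i = 0 then 1 else 0)"

text \<open>The parity before walls are rounded to blocks. Near wall \<open>i\<close> the rounding
  needs the parity of direction \<open>rung i\<close>, which agrees there with the final one; using
  \<open>parity\<close> would make \<open>lowside\<close> circular.\<close>

definition pre_parity :: "nat \<Rightarrow> 'a \<Rightarrow> bool" where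
  "pre_parity i x = (if \<delta> x \<le> 20 * int i then qS i x else qT i x)"

text \<open>For an alternating parity \<open>b\<close> this is an involution, pairing the start of
  an edge of parity False with its end.\<close>

definition mate :: "bool \<Rightarrow> nat \<Rightarrow> 'a \<Rightarrow> 'a" where
  "mate b i x = (if b then \<psi> i x else \<phi> i x)"

text \<open>The sublevel set \<open>\<delta> \<le> 20 * i\<close> is enlarged to a union of two by two blocks, so that near the
  wall it contains edges of direction \<open>rung i\<close> in whole and along direction \<open>i\<close> changes
  only every other step.\<close>

definition lowside :: "nat \<Rightarrow> 'a \<Rightarrow> bool" where
  "lowside i x \<longleftrightarrow> (let s = mate (qS i x) i; t = mate (pre_parity (rung i) x) (rung i) in
     \<exists>y\<in>{x, s x, t x, s (t x)}. \<delta> y \<le> 20 * int i)"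

definition parity :: "nat \<Rightarrow> 'a \<Rightarrow> bool" where
  "parity i x = (if lowside i x then qS i x else qT i x)"

text \<open>The edge to be recoloured is the one leaving \<open>x\<close>, not the one arriving at
  \<open>x\<close> across the wall. It lies inside a block, and \<open>defective\<close> marks its
  two ends.\<close>

definition defect :: "nat \<Rightarrow> 'a \<Rightarrow> bool" where
  "defect i x \<longleftrightarrow> lowside i x \<noteq> lowside i (\<psi> i x)"

definition defective :: "nat \<Rightarrow> 'a \<Rightarrow> bool" where
  "defective i x \<longleftrightarrow> defect i x \<or> defect i (\<psi> i x)"

text \<open>The colour that is missing at a defective vertex once the defect has been given the
  colour of the rungs.\<close>

definition replacement :: "nat \<Rightarrow> 'a \<Rightarrow> nat \<times> bool" where
  "replacement i x = (i, if defect i x then \<not> parity i (\<psi> i x) else \<not> parity i x)"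

text \<open>The colour of the edge from \<open>x\<close> to \<open>\<phi> k x\<close>. Rungs are
  edges of parity False in direction \<open>rung i\<close>. \<open>LEAST\<close> merely names the
  wall a rung belongs to, since at a point of the space at most one direction is defective.\<close>

definition colour :: "nat \<Rightarrow> 'a \<Rightarrow> nat \<times> bool" where
  "colour k x =
    (if defect k x then (rung k, False)
     else if \<not> parity k x \<and> (\<exists>i<d. rung i = k \<and> defective i x)
     then replacement (LEAST i. i < d \<and> rung i = k \<and> defective i x) x
     else (k, parity k x))"

section \<open>Sides and defects near one wall\<close>

lemma rung [simp]: "rung i < d" "rung i \<noteq> i" "i \<noteq> rung i"
  using d_gt_1 by (auto simp: rung_def)

lemma \<delta>_inv: "x \<in> space M \<Longrightarrow> i < d \<Longrightarrow> \<bar>\<delta> (\<psi> i x) - \<delta> x\<bar> \<le> 1"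
  using \<delta>_generator[of "\<psi> i x" i] by simp

lemma mate_closed [simp]: "x \<in> space M \<Longrightarrow> i < d \<Longrightarrow> mate b i x \<in> space M"
  by (simp add: mate_def)

lemma \<delta>_mate: "x \<in> space M \<Longrightarrow> i < d \<Longrightarrow> \<bar>\<delta> (mate b i x) - \<delta> x\<bar> \<le> 1"
  using \<delta>_generator \<delta>_inv by (simp add: mate_def)

lemma mate_commute:
  "x \<in> space M \<Longrightarrow> i < d \<Longrightarrow> j < d \<Longrightarrow> mate b j (\<phi> i x) = \<phi> i (mate b j x)"
  by (simp add: mate_def generator_commute generator_inv_commute)

lemma lowside_bounds:
  assumes x: "x \<in> space M" "i < d"
  shows "lowside i x \<Longrightarrow> \<delta> x \<le> 20 * int i + 2" "\<not> lowside i x \<Longrightarrow> 20 * int i < \<delta> x"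
proof -
  let ?s = "mate (qS i x) i" and ?t = "mate (pre_parity (rung i) x) (rung i)"
  have "\<bar>\<delta> (?s x) - \<delta> x\<bar> \<le> 1" "\<bar>\<delta> (?t x) - \<delta> x\<bar> \<le> 1" "\<bar>\<delta> (?s (?t x)) - \<delta> (?t x)\<bar> \<le> 1"
    using x by (simp_all add: \<delta>_mate)
  then show "lowside i x \<Longrightarrow> \<delta> x \<le> 20 * int i + 2" "\<not> lowside i x \<Longrightarrow> 20 * int i < \<delta> x"
    unfolding lowside_def Let_def by auto
qed

text \<open>The margins 9 and 10 add up to less than the spacing 20. The smaller margins 8, 7 and 6
  below leave room for the steps taken away from the vertex.\<close>

lemma levels_apart:
  fixes a b :: int
  assumes "\<bar>a - 20 * int i\<bar> \<le> 9" "\<bar>a - 20 * int k\<bar> \<le> 10"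
  shows "i = k"
  using assms by linarith

lemma far_from_other_walls:
  assumes "\<bar>\<delta> x - 20 * int i\<bar> \<le> 9" "k \<noteq> i"
  shows "\<delta> x \<le> 20 * int k - 11 \<or> 20 * int k + 11 \<le> \<delta> x"
  using assms by linarith

text \<open>Near wall \<open>i\<close> every other wall is at least 11 levels away, whereas rounding
  moves a wall by at most 2 levels.\<close>

lemma parity_eq_pre_parity:
  assumes "x \<in> space M" "k < d" "k \<noteq> i" "\<bar>\<delta> x - 20 * int i\<bar> \<le> 9"
  shows "parity k x = pre_parity k x"
  using far_from_other_walls[OF assms(4,3)] lowside_bounds[OF assms(1,2)]
  unfolding parity_def pre_parity_def by fastforce

lemma pre_parity_generator:
  assumes "x \<in> space M" "k < d" "l < d" "k \<noteq> i" "\<bar>\<delta> x - 20 * int i\<bar> \<le> 9"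
  shows "pre_parity k (\<phi> l x) \<longleftrightarrow> pre_parity k x \<noteq> (l = k)"
  using far_from_other_walls[OF assms(5,4)] \<delta>_generator[OF assms(1,3)]
    qS_generator[OF assms(1-3)] qT_generator[OF assms(1-3)]
  unfolding pre_parity_def by (elim disjE) (simp_all add: abs_le_iff)

lemma parity_generator:
  assumes "x \<in> space M" "k < d" "l < d" "lowside k (\<phi> l x) = lowside k x"
  shows "parity k (\<phi> l x) \<longleftrightarrow> parity k x \<noteq> (l = k)"
  using lowside_bounds[OF assms(1,2)] lowside_bounds[of "\<phi> l x" k] assms
    qS_generator[OF assms(1-3)] qT_generator[OF assms(1-3)]
  unfolding parity_def by (cases "lowside k x") simp_all

text \<open>The point \<open>\<phi> i x\<close> is the mate of \<open>x\<close>, so both have the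
  same block. The margin ensures that \<open>qS i\<close> alternates between them and that the
  parity of the rungs is the same at both.\<close>

lemma lowside_along:
  assumes x: "x \<in> space M" "i < d" and near: "\<bar>\<delta> x - 20 * int i\<bar> \<le> 8" and q: "\<not> qS i x"
  shows "lowside i (\<phi> i x) = lowside i x"
proof -
  have "\<bar>\<delta> (\<phi> i x) - \<delta> x\<bar> \<le> 1" using \<delta>_generator x by simp
  then have "qS i (\<phi> i x)" using qS_generator[OF x(1,2,2)] near q by simp
  moreover have "pre_parity (rung i) (\<phi> i x) = pre_parity (rung i) x"
    using pre_parity_generator[of x "rung i" i i] x near by simp
  moreover have "mate True i (\<phi> i y) = y" if "y \<in> space M" for y using that x by (simp add: mate_def)
  moreover have "mate False i y = \<phi> i y" for y by (simp add: mate_def)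
  ultimately show ?thesis using x q unfolding lowside_def Let_def by (auto simp: mate_commute)
qed

lemma lowside_rung:
  assumes x: "x \<in> space M" "i < d" and near: "\<bar>\<delta> x - 20 * int i\<bar> \<le> 8" and q: "\<not> pre_parity (rung i) x"
  shows "lowside i (\<phi> (rung i) x) = lowside i x"
proof -
  have "\<bar>\<delta> (\<phi> (rung i) x) - \<delta> x\<bar> \<le> 1" using \<delta>_generator x by simp
  then have "qS i (\<phi> (rung i) x) = qS i x" using qS_generator[OF x, of "rung i"] near by simp
  moreover have "pre_parity (rung i) (\<phi> (rung i) x)"
    using pre_parity_generator[of x "rung i" "rung i" i] x near q by simp
  moreover have "mate True (rung i) (\<phi> (rung i) x) = x" using x by (simp add: mate_def)
  moreover have "mate False (rung i) y = \<phi> (rung i) y" for y by (simp add: mate_def)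
  ultimately show ?thesis using x q unfolding lowside_def Let_def by (auto simp: mate_commute)
qed

lemma defect_level:
  assumes "x \<in> space M" "i < d" "defect i x"
  shows "20 * int i \<le> \<delta> x" "\<delta> x \<le> 20 * int i + 3"
  using assms(3) lowside_bounds[OF assms(1,2)] lowside_bounds[of "\<psi> i x" i] \<delta>_inv[OF assms(1,2)] assms(1,2)
  unfolding defect_def by (auto simp: abs_le_iff)

text \<open>Since \<open>lowside\<close> is constant on blocks, it can only jump along an edge
  between two blocks, that is, one whose start has \<open>qS i\<close> True. Consecutive defects are
  thereby excluded.\<close>

lemma defect_qS:
  assumes x: "x \<in> space M" "i < d" and "defect i x"
  shows "\<not> qS i x" "qS i (\<psi> i x)"
proof -
  note lev = defect_level[OF assms] \<delta>_inv[OF x]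
  have flip: "qS i x \<longleftrightarrow> \<not> qS i (\<psi> i x)"
    using qS_generator[of "\<psi> i x" i i] x lev by simp
  have "lowside i x = lowside i (\<psi> i x)" if "\<not> qS i (\<psi> i x)"
    using lowside_along[of "\<psi> i x" i] x lev that by simp
  then show "\<not> qS i x" "qS i (\<psi> i x)" using assms(3) flip unfolding defect_def by blast+
qed

lemma defect_not_adjacent:
  assumes "x \<in> space M" "i < d" "defect i x"
  shows "\<not> defect i (\<psi> i x)"
  using defect_qS[OF assms] defect_qS(1)[of "\<psi> i x" i] assms by auto

text \<open>The two ends of a rung share a block, and so do their predecessors in direction
  \<open>i\<close>; hence defects occur in pairs joined by rungs.\<close>

lemma defect_rung:
  assumes x: "x \<in> space M" "i < d" and near: "\<bar>\<delta> x - 20 * int i\<bar> \<le> 7" and q: "\<not> pre_parity (rung i) x"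
  shows "defect i (\<phi> (rung i) x) = defect i x"
proof -
  have lev: "\<bar>\<delta> (\<psi> i x) - 20 * int i\<bar> \<le> 8" using \<delta>_inv[OF x] near by linarith
  have "pre_parity (rung i) x \<longleftrightarrow> pre_parity (rung i) (\<psi> i x)"
    using pre_parity_generator[of "\<psi> i x" "rung i" i i] x lev by simp
  then have "lowside i (\<phi> (rung i) (\<psi> i x)) = lowside i (\<psi> i x)"
    using lowside_rung[of "\<psi> i x" i] x lev q by simp
  moreover have "lowside i (\<phi> (rung i) x) = lowside i x" using lowside_rung x near q by simp
  ultimately show ?thesis unfolding defect_def using x by (simp add: generator_inv_commute[symmetric])
qed

lemma defective_rung:
  assumes x: "x \<in> space M" "i < d" and near: "\<bar>\<delta> x - 20 * int i\<bar> \<le> 6" and q: "\<not> pre_parity (rung i) x"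
  shows "defective i (\<phi> (rung i) x) = defective i x"
proof -
  have lev: "\<bar>\<delta> (\<psi> i x) - 20 * int i\<bar> \<le> 7" using \<delta>_inv[OF x] near by linarith
  have "pre_parity (rung i) x \<longleftrightarrow> pre_parity (rung i) (\<psi> i x)"
    using pre_parity_generator[of "\<psi> i x" "rung i" i i] x lev by simp
  then have "defect i (\<phi> (rung i) (\<psi> i x)) = defect i (\<psi> i x)"
    using defect_rung[of "\<psi> i x" i] x lev q by simp
  moreover have "defect i (\<phi> (rung i) x) = defect i x" using defect_rung x near q by simp
  ultimately show ?thesis unfolding defective_def using x by (simp add: generator_inv_commute[symmetric])
qed

lemma defective_level:
  assumes "x \<in> space M" "i < d" "defective i x"
  shows "\<bar>\<delta> x - 20 * int i\<bar> \<le> 4"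
  using assms(3) defect_level[OF assms(1,2)] defect_level[of "\<psi> i x" i] \<delta>_inv[OF assms(1,2)] assms(1,2)
  unfolding defective_def by auto

lemma defective_unique:
  assumes "x \<in> space M" "i < d" "k < d" "defective k x" "\<bar>\<delta> x - 20 * int i\<bar> \<le> 9"
  shows "k = i"
  using levels_apart[OF assms(5), of k] defective_level[OF assms(1,3,4)] by auto

lemma parity_inv:
  assumes "x \<in> space M" "k < d" "\<not> defect k x"
  shows "parity k (\<psi> k x) = (\<not> parity k x)"
  using parity_generator[of "\<psi> k x" k k] assms by (simp add: defect_def)

text \<open>Used in contrapositive form: a vertex that is not defective receives no recoloured rung
  from its predecessor.\<close>

lemma defective_of_rung_inv:
  assumes x: "x \<in> space M" "i < d" and "defective i (\<psi> (rung i) x)" "\<not> parity (rung i) (\<psi> (rung i) x)"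
  shows "defective i x"
proof -
  let ?y = "\<psi> (rung i) x"
  have y: "?y \<in> space M" using x by simp
  have lev: "\<bar>\<delta> ?y - 20 * int i\<bar> \<le> 4" using defective_level[OF y x(2) assms(3)] .
  then have "\<not> pre_parity (rung i) ?y"
    using parity_eq_pre_parity[of ?y "rung i" i] assms(4) y by simp
  then show ?thesis using defective_rung[OF y x(2)] lev assms(3) x by simp
qed

lemma colour_ordinary:
  assumes x: "x \<in> space M" "k < d" "\<not> defective k x"
    and rungs: "\<And>i. i < d \<Longrightarrow> rung i = k \<Longrightarrow> \<not> defective i x"
  shows "colour k x = (k, parity k x)" "colour k (\<psi> k x) = (k, \<not> parity k x)"
proof -
  have nd: "\<not> defect k x" "\<not> defect k (\<psi> k x)" using x(3) by (auto simp: defective_def)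
  then show "colour k x = (k, parity k x)" using rungs by (auto simp: colour_def)
  have normal: "\<not> (\<not> parity k (\<psi> k x) \<and> (\<exists>i<d. rung i = k \<and> defective i (\<psi> k x)))"
    using defective_of_rung_inv[OF x(1)] rungs by blast
  have "colour k (\<psi> k x) = (k, parity k (\<psi> k x))"
    unfolding colour_def if_not_P[OF normal] if_not_P[OF nd(2)] ..
  then show "colour k (\<psi> k x) = (k, \<not> parity k x)"
    using parity_inv[OF x(1,2) nd(1)] by simp
qed

lemma colour_rung:
  assumes x: "x \<in> space M" "i < d" "defective i x" "\<not> parity (rung i) x"
  shows "colour (rung i) x = replacement i x"
proof -
  have lev: "\<bar>\<delta> x - 20 * int i\<bar> \<le> 9" using defective_level[OF x(1-3)] by simp
  have "\<not> defective (rung i) x" using defective_unique[OF x(1,2) _ _ lev, of "rung i"] by auto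
  then have "\<not> defect (rung i) x" by (simp add: defective_def)
  moreover have "(LEAST i'. i' < d \<and> rung i' = rung i \<and> defective i' x) = i"
  proof (rule Least_equality)
    fix k assume "k < d \<and> rung k = rung i \<and> defective k x"
    then have "k = i" by (intro defective_unique[OF x(1,2) _ _ lev]) simp_all
    then show "i \<le> k" by simp
  qed (use x in simp)
  ultimately show ?thesis using x unfolding colour_def by auto
qed

text \<open>One colour must serve both ends of a rung. It does, because \<open>lowside i\<close>,
  and with it the parity of direction \<open>i\<close>, agrees at the two ends and at their
  predecessors.\<close>

lemma replacement_rung:
  assumes x: "x \<in> space M" "i < d" "\<bar>\<delta> x - 20 * int i\<bar> \<le> 6" "\<not> pre_parity (rung i) x"
  shows "replacement i (\<phi> (rung i) x) = replacement i x"
proof -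
  have lev: "\<bar>\<delta> (\<psi> i x) - 20 * int i\<bar> \<le> 7" using \<delta>_inv[OF x(1,2)] x(3) by linarith
  have "pre_parity (rung i) x \<longleftrightarrow> pre_parity (rung i) (\<psi> i x)"
    using pre_parity_generator[of "\<psi> i x" "rung i" i i] x lev by simp
  then have "lowside i (\<phi> (rung i) (\<psi> i x)) = lowside i (\<psi> i x)" "lowside i (\<phi> (rung i) x) = lowside i x"
    using lowside_rung[of "\<psi> i x" i] lowside_rung[of x i] x lev by simp_all
  then have "parity i (\<phi> (rung i) (\<psi> i x)) = parity i (\<psi> i x)" "parity i (\<phi> (rung i) x) = parity i x"
    using parity_generator[of "\<psi> i x" i "rung i"] parity_generator[of x i "rung i"] x by simp_all
  moreover have "defect i (\<phi> (rung i) x) = defect i x" using defect_rung x by simp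
  ultimately show ?thesis using x by (simp add: replacement_def generator_inv_commute[symmetric])
qed

text \<open>The defect takes the colour of the rung and the rung takes the colour freed by the
  defect, so the two directions keep their four colours. The cases distinguish whether
  \<open>x\<close> is the start or the end of its rung, and the start or the end of its
  defect.\<close>

lemma colour_at_defective:
  assumes x: "x \<in> space M" "i < d" "defective i x"
  shows "{colour (rung i) x, colour (rung i) (\<psi> (rung i) x)} = {(rung i, True), replacement i x}"
    "\<exists>b. {colour i x, colour i (\<psi> i x)} = {(rung i, False), (i, b)} \<and> replacement i x = (i, \<not> b)"
proof -
  let ?j = "rung i"
  have lev: "\<bar>\<delta> x - 20 * int i\<bar> \<le> 4" using defective_level[OF x] .
  have nj: "\<not> defective ?j x" using defective_unique[OF x(1,2), of ?j] lev by auto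
  then have njd: "\<not> defect ?j x" "\<not> defect ?j (\<psi> ?j x)" by (auto simp: defective_def)
  have flip: "parity ?j (\<psi> ?j x) = (\<not> parity ?j x)" using parity_inv x njd by simp
  show "{colour ?j x, colour ?j (\<psi> ?j x)} = {(?j, True), replacement i x}"
  proof (cases "parity ?j x")
    case False
    then have "colour ?j (\<psi> ?j x) = (?j, True)" using flip njd by (simp add: colour_def)
    then show ?thesis using colour_rung[OF x False] by auto
  next
    case True
    let ?y = "\<psi> ?j x"
    have y: "?y \<in> space M" using x by simp
    have ylev: "\<bar>\<delta> ?y - 20 * int i\<bar> \<le> 6" using \<delta>_inv[of x ?j] x lev by simp
    have py: "\<not> parity ?j ?y" using flip True by simp
    then have ppy: "\<not> pre_parity ?j ?y" using parity_eq_pre_parity[of ?y ?j i] y ylev by simp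
    have "defective i ?y" using defective_rung[OF y x(2) ylev ppy] x by simp
    then have "colour ?j ?y = replacement i ?y" using colour_rung[OF y x(2)] py by blast
    also have "\<dots> = replacement i x" using replacement_rung[OF y x(2) ylev ppy] x by simp
    finally have "colour ?j ?y = replacement i x" .
    moreover have "colour ?j x = (?j, True)" using True njd by (simp add: colour_def)
    ultimately show ?thesis by auto
  qed
  \<comment> \<open>The edges of direction \<open>i\<close> at \<open>x\<close> are not recoloured
    as rungs of another wall: a direction defective at one of their starting points must be
    \<open>i\<close>, and \<open>i\<close> is not its own rung direction.\<close>
  have no_rung: "\<not> (\<exists>k<d. rung k = i \<and> defective k y)" if "y \<in> {x, \<psi> i x}" for y
  proof -
    have "y \<in> space M" "\<bar>\<delta> y - 20 * int i\<bar> \<le> 9" using that x lev \<delta>_inv[OF x(1,2)] by auto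
    then have "k = i" if "k < d" "defective k y" for k
      using that x(2) by (intro defective_unique[of y i k])
    then show ?thesis using rung(2)[of i] by metis
  qed
  show "\<exists>b. {colour i x, colour i (\<psi> i x)} = {(?j, False), (i, b)} \<and> replacement i x = (i, \<not> b)"
  proof (cases "defect i x")
    case True
    then have "\<not> defect i (\<psi> i x)" using defect_not_adjacent x by blast
    then have "colour i (\<psi> i x) = (i, parity i (\<psi> i x))" using no_rung[of "\<psi> i x"] by (auto simp: colour_def)
    then show ?thesis using True by (auto simp: colour_def replacement_def)
  next
    case False
    then have "defect i (\<psi> i x)" using x(3) by (simp add: defective_def)
    moreover have "colour i x = (i, parity i x)" using False no_rung[of x] by (auto simp: colour_def)
    ultimately show ?thesis using False by (auto simp: colour_def[of i "\<psi> i x"] replacement_def)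
  qed
qed

section \<open>All colours at one vertex\<close>

definition incident_colour :: "'a \<Rightarrow> nat \<times> bool \<Rightarrow> nat \<times> bool" where
  "incident_colour x e = (if snd e then colour (fst e) x else colour (fst e) (\<psi> (fst e) x))"

lemma colours_at:
  assumes "k < d"
  shows "{colour k x, colour k (\<psi> k x)} \<subseteq> incident_colour x ` half_edges d"
proof -
  have "colour k x = incident_colour x (k, True)" "colour k (\<psi> k x) = incident_colour x (k, False)"
    by (simp_all add: incident_colour_def)
  then show ?thesis using assms by (auto intro: image_eqI[of _ _ "(k, _)"])
qed

text \<open>At most one direction \<open>i\<close> is defective at \<open>x\<close>. If there is
  one, \<open>i\<close> and \<open>rung i\<close> jointly supply their four colours, and every
  remaining direction supplies its own two.\<close>

lemma colours_onto:
  assumes x: "x \<in> space M"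
  shows "half_edges d \<subseteq> incident_colour x ` half_edges d"
proof
  fix e assume "e \<in> half_edges d"
  then obtain k b where e: "e = (k, b)" "k < d" by (cases e) auto
  show "e \<in> incident_colour x ` half_edges d"
  proof (cases "\<exists>i<d. defective i x")
    case False
    then have "{colour k x, colour k (\<psi> k x)} = {(k, parity k x), (k, \<not> parity k x)}"
      using colour_ordinary[OF x e(2)] e(2) by simp
    then have "e \<in> {colour k x, colour k (\<psi> k x)}" using e by (cases "b = parity k x") auto
    then show ?thesis using colours_at[OF e(2)] by blast
  next
    case True
    then obtain i where i: "i < d" "defective i x" by blast
    have uniq: "k' = i" if "k' < d" "defective k' x" for k'
      using defective_unique[OF x i(1) that] defective_level[OF x i] by simp
    obtain c where c: "{colour i x, colour i (\<psi> i x)} = {(rung i, False), (i, c)}" "replacement i x = (i, \<not> c)"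
      using colour_at_defective(2)[OF x i] by blast
    have j: "{colour (rung i) x, colour (rung i) (\<psi> (rung i) x)} = {(rung i, True), (i, \<not> c)}"
      using colour_at_defective(1)[OF x i] c(2) by simp
    consider "k = i" | "k = rung i" | "k \<noteq> i" "k \<noteq> rung i" by blast
    then show ?thesis
    proof cases
      case 1
      then have "e \<in> {(rung i, False), (i, c)} \<union> {(rung i, True), (i, \<not> c)}" using e by auto
      then show ?thesis using colours_at[OF i(1), of x] colours_at[of "rung i" x] unfolding c(1) j by auto
    next
      case 2
      then have "e \<in> {(rung i, False), (i, c)} \<union> {(rung i, True), (i, \<not> c)}" using e by auto
      then show ?thesis using colours_at[OF i(1), of x] colours_at[of "rung i" x] unfolding c(1) j by auto
    next
      case 3
      have nd: "\<not> defective k x" using uniq[OF e(2)] 3(1) by auto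
      have "\<not> defective k' x" if "k' < d" "rung k' = k" for k' using uniq[OF that(1)] that(2) 3(2) by auto
      then have "{colour k x, colour k (\<psi> k x)} = {(k, parity k x), (k, \<not> parity k x)}"
        using colour_ordinary[OF x e(2) nd] by simp
      then have "e \<in> {colour k x, colour k (\<psi> k x)}" using e by (cases "b = parity k x") auto
      then show ?thesis using colours_at[OF e(2)] by blast
    qed
  qed
qed

lemma finite_half_edges: "finite (half_edges d)"
  by (simp add: half_edges_def)

lemma incident_colour_inj:
  assumes "x \<in> space M"
  shows "inj_on (incident_colour x) (half_edges d)"
  by (rule finite_surj_inj[OF finite_half_edges colours_onto[OF assms]])

text \<open>The colours at \<open>x\<close> include all of \<open>half_edges d\<close> and are no
  more numerous, so there are no others.\<close>

lemma colour_range: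
  assumes x: "x \<in> space M" "k < d"
  shows "colour k x \<in> half_edges d"
proof -
  have "card (incident_colour x ` half_edges d) = card (half_edges d)"
    using card_image[OF incident_colour_inj[OF x(1)]] .
  then have "half_edges d = incident_colour x ` half_edges d"
    using colours_onto[OF x(1)] finite_half_edges by (intro card_subset_eq) auto
  then show ?thesis using colours_at[OF x(2), of x] by blast
qed

end

section \<open>Measurability and the chromatic number\<close>

context parity_walls
begin

text \<open>A mate depends on \<open>x\<close> through a Boolean that selects
  \<open>\<phi> i\<close> or \<open>\<psi> i\<close>, so a predicate of a mate is a finite
  combination of predicates composed with these maps.\<close>

lemma measurable_colour:
  assumes \<delta>: "\<delta> \<in> measurable M (count_space UNIV)"
    and q: "\<And>i. i < d \<Longrightarrow> Measurable.pred M (qS i)" "\<And>i. i < d \<Longrightarrow> Measurable.pred M (qT i)"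
    and k: "k < d"
  shows "colour k \<in> measurable M (count_space UNIV)"
proof -
  have gen: "Measurable.pred M (\<lambda>x. P (\<phi> i x))" "Measurable.pred M (\<lambda>x. P (\<psi> i x))"
    if "Measurable.pred M P" "i < d" for P i
    using measurable_compose[OF measurable_generator[OF that(2)] that(1)]
      measurable_compose[OF measurable_inv_generator[OF that(2)] that(1)] .
  have le: "Measurable.pred M (\<lambda>x. \<delta> x \<le> a)" for a using \<delta> by measurable
  have pre: "Measurable.pred M (pre_parity i)" if "i < d" for i
    unfolding pre_parity_def using le q[OF that] by measurable
  have mate: "Measurable.pred M (\<lambda>x. P (mate (b x) i x))"
    if "Measurable.pred M P" "Measurable.pred M b" "i < d" for P b i
  proof -
    have "(\<lambda>x. P (mate (b x) i x)) = (\<lambda>x. (b x \<and> P (\<psi> i x)) \<or> (\<not> b x \<and> P (\<phi> i x)))"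
      by (auto simp: mate_def)
    then show ?thesis using that(2) gen[OF that(1,3)] by simp
  qed
  have mate2: "Measurable.pred M (\<lambda>x. P (mate (b x) i (mate (c x) j x)))"
    if "Measurable.pred M P" "Measurable.pred M b" "Measurable.pred M c" "i < d" "j < d" for P b c i j
  proof -
    have "(\<lambda>x. P (mate (b x) i (mate (c x) j x))) =
      (\<lambda>x. (b x \<and> P (mate True i (mate (c x) j x))) \<or> (\<not> b x \<and> P (mate False i (mate (c x) j x))))"
      by (rule ext) (metis (full_types))
    moreover have "Measurable.pred M (\<lambda>x. P (mate b' i (mate (c x) j x)))" for b'
      using mate[OF mate[OF that(1) _ that(4)] that(3,5), of "\<lambda>_. b'"] by simp
    ultimately show ?thesis using that(2) by simp
  qed
  have low: "Measurable.pred M (lowside i)" if i: "i < d" for i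
  proof -
    let ?s = "\<lambda>x. mate (qS i x) i" and ?t = "\<lambda>x. mate (pre_parity (rung i) x) (rung i) x"
    note le' = le[of "20 * int i"]
    have "Measurable.pred M (\<lambda>x. \<delta> x \<le> 20 * int i \<or> \<delta> (?s x x) \<le> 20 * int i \<or>
        \<delta> (?t x) \<le> 20 * int i \<or> \<delta> (?s x (?t x)) \<le> 20 * int i)"
      by (intro pred_intros_logic le' mate[OF le'] mate2[OF le'] q pre i) simp_all
    then show ?thesis unfolding lowside_def Let_def by simp
  qed
  have par: "Measurable.pred M (parity i)" if "i < d" for i
    unfolding parity_def using low[OF that] q[OF that] by measurable
  have def: "Measurable.pred M (defect i)" if "i < d" for i
    unfolding defect_def using low[OF that] gen(2)[OF low[OF that] that] by simp
  have dfv: "Measurable.pred M (\<lambda>x. i < d \<and> rung i = k \<and> defective i x)" for i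
    unfolding defective_def using def[of i] gen(2)[OF def, of i i]
    by (cases "i < d \<and> rung i = k") auto
  \<comment> \<open>The default \<open>(0, False)\<close> gives a measurable function for every
    natural \<open>i\<close>, as composition with the measurable index \<open>?L\<close> requires.
    Where the replacement is used, the index is below \<open>d\<close>.\<close>
  have rep: "(\<lambda>x. if i < d then replacement i x else (0, False)) \<in> measurable M (count_space UNIV)" for i
  proof (cases "i < d")
    case True
    have [measurable]: "Measurable.pred M (defect i)" "Measurable.pred M (parity i)"
      "Measurable.pred M (\<lambda>x. parity i (\<psi> i x))"
      using def par gen(2)[OF par] True by auto
    have "Measurable.pred M (\<lambda>x. if defect i x then \<not> parity i (\<psi> i x) else \<not> parity i x)" by measurable
    then have "(\<lambda>x. (i, if defect i x then \<not> parity i (\<psi> i x) else \<not> parity i x)) \<in> measurable M (count_space UNIV)"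
      by (rule measurable_compose) simp
    then show ?thesis using True by (simp add: replacement_def)
  qed simp
  let ?L = "\<lambda>x. LEAST i. i < d \<and> rung i = k \<and> defective i x"
  have L: "?L \<in> measurable M (count_space UNIV)" by (intro measurable_Least dfv)
  have rL: "(\<lambda>x. if ?L x < d then replacement (?L x) x else (0, False)) \<in> measurable M (count_space UNIV)"
    using measurable_compose_countable[OF rep L] .
  have pk: "(\<lambda>x. (k, parity k x)) \<in> measurable M (count_space UNIV)"
    using par[OF k] by (rule measurable_compose) simp
  have cond: "Measurable.pred M (\<lambda>x. \<not> parity k x \<and> (\<exists>i. i < d \<and> rung i = k \<and> defective i x))"
    using par[OF k] by (intro pred_intros_logic pred_intros_countable dfv)
  have "colour k = (\<lambda>x. if defect k x then (rung k, False)
     else if \<not> parity k x \<and> (\<exists>i. i < d \<and> rung i = k \<and> defective i x)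
     then if ?L x < d then replacement (?L x) x else (0, False)
     else (k, parity k x))"
  proof
    fix x
    have "?L x < d" if "\<exists>i. i < d \<and> rung i = k \<and> defective i x"
      using LeastI_ex[OF that] by blast
    then show "colour k x = (if defect k x then (rung k, False)
     else if \<not> parity k x \<and> (\<exists>i. i < d \<and> rung i = k \<and> defective i x)
     then if ?L x < d then replacement (?L x) x else (0, False)
     else (k, parity k x))" unfolding colour_def by auto
  qed
  moreover have "\<dots> \<in> measurable M (count_space UNIV)"
    by (intro measurable_If rL pk def[OF k, unfolded pred_def] cond[unfolded pred_def]) simp
  ultimately show ?thesis by (simp only:)
qed

end

context free_lattice_action
begin

lemma ex_half_edge_colouring:
  assumes d: "1 < d"
  obtains col :: "nat \<Rightarrow> 'a \<Rightarrow> nat \<times> bool" where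
    "\<And>k. k < d \<Longrightarrow> col k \<in> measurable M (count_space UNIV)"
    "\<And>k x. k < d \<Longrightarrow> x \<in> space M \<Longrightarrow> col k x \<in> half_edges d"
    "\<And>x. x \<in> space M \<Longrightarrow>
       inj_on (\<lambda>e. if snd e then col (fst e) x else col (fst e) (\<psi> (fst e) x)) (half_edges d)"
proof -
  \<comment> \<open>The largest level at which finite components are needed is
    \<open>20 * (d - 1) + 10\<close>, below the cut-off.\<close>
  obtain \<delta> :: "'a \<Rightarrow> int" where \<delta>: "\<delta> \<in> measurable M (count_space UNIV)"
    "\<And>x i. x \<in> space M \<Longrightarrow> i < d \<Longrightarrow> \<bar>\<delta> (\<phi> i x) - \<delta> x\<bar> \<le> 1"
    "\<And>a x. x \<in> space M \<Longrightarrow> 0 \<le> a \<Longrightarrow> a < int (20 * d + 20) \<Longrightarrow>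
       finite_components d 1 (visits {y \<in> space M. \<delta> y \<le> a} x)"
    "\<And>a x. x \<in> space M \<Longrightarrow> 0 \<le> a \<Longrightarrow> a < int (20 * d + 20) \<Longrightarrow>
       finite_components d 1 (visits {y \<in> space M. a < \<delta> y} x)"
    using ex_level_function[of "20 * d + 20"] by blast
  have "\<exists>q. i < d \<longrightarrow> Measurable.pred M q \<and> (\<forall>x\<in>space M. \<forall>l<d. \<delta> x \<le> 20 * int i + 10 \<longrightarrow>
      \<delta> (\<phi> l x) \<le> 20 * int i + 10 \<longrightarrow> (q (\<phi> l x) \<longleftrightarrow> q x \<noteq> (l = i)))" for i
  proof (cases "i < d")
    case True
    let ?E = "{y \<in> space M. \<delta> y \<le> 20 * int i + 10}"
    have "?E \<in> sets M" using \<delta>(1) by measurable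
    then obtain q where "Measurable.pred M q"
      "\<And>x l. x \<in> space M \<Longrightarrow> x \<in> ?E \<Longrightarrow> l < d \<Longrightarrow> \<phi> l x \<in> ?E \<Longrightarrow> q (\<phi> l x) \<longleftrightarrow> q x \<noteq> (l = i)"
      using ex_parity[of ?E i] \<delta>(3)[of _ "20 * int i + 10"] True by auto
    then show ?thesis by (intro exI[of _ q]) simp
  qed simp
  then obtain qS where qS: "\<And>i. i < d \<longrightarrow> Measurable.pred M (qS i) \<and> (\<forall>x\<in>space M. \<forall>l<d.
      \<delta> x \<le> 20 * int i + 10 \<longrightarrow> \<delta> (\<phi> l x) \<le> 20 * int i + 10 \<longrightarrow> (qS i (\<phi> l x) \<longleftrightarrow> qS i x \<noteq> (l = i)))"
    by metis
  have "\<exists>q. i < d \<longrightarrow> Measurable.pred M q \<and> (\<forall>x\<in>space M. \<forall>l<d. 20 * int i < \<delta> x \<longrightarrow>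
      20 * int i < \<delta> (\<phi> l x) \<longrightarrow> (q (\<phi> l x) \<longleftrightarrow> q x \<noteq> (l = i)))" for i
  proof (cases "i < d")
    case True
    let ?E = "{y \<in> space M. 20 * int i < \<delta> y}"
    have "?E \<in> sets M" using \<delta>(1) by measurable
    then obtain q where "Measurable.pred M q"
      "\<And>x l. x \<in> space M \<Longrightarrow> x \<in> ?E \<Longrightarrow> l < d \<Longrightarrow> \<phi> l x \<in> ?E \<Longrightarrow> q (\<phi> l x) \<longleftrightarrow> q x \<noteq> (l = i)"
      using ex_parity[of ?E i] \<delta>(4)[of _ "20 * int i"] True by auto
    then show ?thesis by (intro exI[of _ q]) simp
  qed simp
  then obtain qT where qT: "\<And>i. i < d \<longrightarrow> Measurable.pred M (qT i) \<and> (\<forall>x\<in>space M. \<forall>l<d.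
      20 * int i < \<delta> x \<longrightarrow> 20 * int i < \<delta> (\<phi> l x) \<longrightarrow> (qT i (\<phi> l x) \<longleftrightarrow> qT i x \<noteq> (l = i)))"
    by metis
  interpret parity_walls d M \<phi> \<delta> qS qT
    by standard (use d \<delta>(2) qS qT in blast)+
  show thesis
  proof (rule that[of colour])
    show "colour k \<in> measurable M (count_space UNIV)" if "k < d" for k
      by (rule measurable_colour) (use that \<delta>(1) qS qT in blast)+
    show "inj_on (\<lambda>e. if snd e then colour (fst e) x else colour (fst e) (\<psi> (fst e) x)) (half_edges d)"
      if "x \<in> space M" for x
      using incident_colour_inj[OF that] unfolding incident_colour_def .
  qed (rule colour_range)
qed

section \<open>Half-edges and edges of the generated graph\<close>

definition neighbour :: "'a \<Rightarrow> nat \<times> bool \<Rightarrow> 'a" where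
  "neighbour x e = (if snd e then \<phi> (fst e) x else \<psi> (fst e) x)"

lemma neighbour_closed: "x \<in> space M \<Longrightarrow> e \<in> half_edges d \<Longrightarrow> neighbour x e \<in> space M"
  by (cases e) (simp add: neighbour_def)

text \<open>Different half-edges belong to different signed unit vectors, which freeness sends to
  different points. Hence an ordered edge determines its half-edge, and every vertex has degree
  \<open>2 * d\<close>.\<close>

lemma neighbour_inj:
  assumes x: "x \<in> space M"
  shows "inj_on (neighbour x) (half_edges d)"
proof (rule inj_onI)
  fix e e' assume e: "e \<in> half_edges d" "e' \<in> half_edges d" "neighbour x e = neighbour x e'"
  let ?v = "\<lambda>e. axis_vec (fst e) (if snd e then 1 else - 1)"
  have n: "neighbour x e = act (?v e) x" if "e \<in> half_edges d" for e
    using that by (cases e) (simp add: neighbour_def act_axis_vec_one)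
  have "?v e = ?v e'"
    by (rule act_inj[OF x]) (use e n in \<open>auto simp: half_edges_def intro: axis_vec_lattice\<close>)
  then have "?v e (fst e) = ?v e' (fst e)" by (rule fun_cong)
  then show "e = e'" by (auto simp: axis_vec_def prod_eq_iff split: if_splits)
qed

lemma generated_graph_iff:
  "(x, y) \<in> generated_graph d M \<phi> \<longleftrightarrow> x \<in> space M \<and> (\<exists>e\<in>half_edges d. y = neighbour x e)"
proof
  assume "(x, y) \<in> generated_graph d M \<phi>"
  then obtain i where xy: "x \<in> space M" "y \<in> space M" "i < d" "y = \<phi> i x \<or> x = \<phi> i y"
    unfolding generated_graph_def by blast
  then have "y = neighbour x (i, True) \<or> y = neighbour x (i, False)"
    by (auto simp: neighbour_def)
  then show "x \<in> space M \<and> (\<exists>e\<in>half_edges d. y = neighbour x e)" using xy by (metis half_edges_iff)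
next
  assume "x \<in> space M \<and> (\<exists>e\<in>half_edges d. y = neighbour x e)"
  then obtain i b where "x \<in> space M" "i < d" "y = neighbour x (i, b)" by auto
  then show "(x, y) \<in> generated_graph d M \<phi>"
    unfolding generated_graph_def by (auto simp: neighbour_def)
qed

end

definition encode_colour :: "nat \<times> bool \<Rightarrow> nat" where
  "encode_colour e = 2 * fst e + of_bool (snd e)"

lemma encode_colour_inj: "encode_colour e = encode_colour e' \<Longrightarrow> e = e'"
  unfolding encode_colour_def
  by (cases "snd e"; cases "snd e'"; simp add: prod_eq_iff; presburger)

lemma encode_colour_less: "e \<in> half_edges d \<Longrightarrow> encode_colour e < 2 * d"
  by (cases e) (auto simp: encode_colour_def of_bool_def)

lemma card_half_edges: "card (half_edges d) = 2 * d"
  by (simp add: half_edges_def card_cartesian_product)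

text \<open>Testing one implication suffices, as distinct points admit a test set containing the
  first but not the second. Measurability refers here to the product sigma-algebra, on which edge
  colourings are measured.\<close>

lemma pred_graph:
  assumes "standard_borel M" "f \<in> measurable M M"
  shows "Measurable.pred (M \<Otimes>\<^sub>M M) (\<lambda>p. snd p = f (fst p))"
proof -
  obtain W :: "nat \<Rightarrow> 'a set" where W: "\<And>n. W n \<in> sets M"
    "\<And>x Q. x \<in> space M \<Longrightarrow> finite Q \<Longrightarrow> x \<notin> Q \<Longrightarrow> \<exists>n. x \<in> W n \<and> W n \<inter> Q = {}"
    using standard_borel_base[OF assms(1)] by blast
  note W(1)[measurable] assms(2)[measurable]
  have sep: "x = y" if xy: "x \<in> space M" "y \<in> space M" "\<forall>n. x \<in> W n \<longrightarrow> y \<in> W n" for x y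
    
  proof (rule ccontr)
    assume "x \<noteq> y"
    then obtain n where "x \<in> W n" "W n \<inter> {y} = {}" using W(2)[OF xy(1), of "{y}"] by auto
    then show False using xy(3) by auto
  qed
  have "Measurable.pred (M \<Otimes>\<^sub>M M) (\<lambda>p. \<forall>n. snd p \<in> W n \<longrightarrow> f (fst p) \<in> W n)" by measurable
  moreover have "(\<forall>n. snd p \<in> W n \<longrightarrow> f (fst p) \<in> W n) \<longleftrightarrow> snd p = f (fst p)"
    if "p \<in> space (M \<Otimes>\<^sub>M M)" for p
  proof -
    have "snd p \<in> space M" "f (fst p) \<in> space M"
      using that measurable_space[OF assms(2)] by (auto simp: space_pair_measure)
    then have "snd p = f (fst p)" if "\<forall>n. snd p \<in> W n \<longrightarrow> f (fst p) \<in> W n"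
      using that by (rule sep)
    moreover have "\<forall>n. snd p \<in> W n \<longrightarrow> f (fst p) \<in> W n" if "snd p = f (fst p)"
      unfolding that by blast
    ultimately show ?thesis by (rule iffI)
  qed
  ultimately show ?thesis by (simp cong: measurable_cong)
qed

context free_lattice_action
begin

context
  fixes col :: "nat \<Rightarrow> 'a \<Rightarrow> nat \<times> bool" and inc :: "'a \<Rightarrow> nat \<times> bool \<Rightarrow> nat"
  assumes col_meas: "\<And>k. k < d \<Longrightarrow> col k \<in> measurable M (count_space UNIV)"
    and col_range: "\<And>k x. k < d \<Longrightarrow> x \<in> space M \<Longrightarrow> col k x \<in> half_edges d"
    and col_inj: "\<And>x. x \<in> space M \<Longrightarrow>
       inj_on (\<lambda>e. if snd e then col (fst e) x else col (fst e) (\<psi> (fst e) x)) (half_edges d)"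
  defines "inc \<equiv> \<lambda>x e. encode_colour (if snd e then col (fst e) x else col (fst e) (\<psi> (fst e) x))"
begin

lemma inc_inj:
  assumes "x \<in> space M" shows "inj_on (inc x) (half_edges d)"
proof (rule inj_onI)
  fix e e' assume e: "e \<in> half_edges d" "e' \<in> half_edges d" "inc x e = inc x e'"
  then show "e = e'"
    using inj_onD[OF col_inj[OF assms], of e e'] encode_colour_inj unfolding inc_def by simp
qed

lemma inc_less: "x \<in> space M \<Longrightarrow> e \<in> half_edges d \<Longrightarrow> inc x e < 2 * d"
  unfolding inc_def by (cases e) (auto intro!: encode_colour_less col_range)

lemma inc_meas:
  assumes "e \<in> half_edges d" shows "(\<lambda>x. inc x e) \<in> measurable M (count_space UNIV)"
proof -
  have k: "fst e < d" using assms by (cases e) simp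
  have "(\<lambda>x. encode_colour (col (fst e) x)) \<in> measurable M (count_space UNIV)"
    "(\<lambda>x. encode_colour (col (fst e) (\<psi> (fst e) x))) \<in> measurable M (count_space UNIV)"
    by (rule measurable_compose[OF col_meas[OF k]], simp)
      (rule measurable_compose[OF measurable_compose[OF measurable_inv_generator[OF k] col_meas[OF k]]], simp)
  then show ?thesis unfolding inc_def by (cases "snd e") simp_all
qed

text \<open>Seen from its other end, an edge is the opposite half-edge. This yields both the
  consistency of vertex labels and the symmetry of the edge colouring.\<close>

lemma inc_neighbour:
  assumes "x \<in> space M" "(i, b) \<in> half_edges d"
  shows "inc (neighbour x (i, b)) (i, \<not> b) = inc x (i, b)" "neighbour (neighbour x (i, b)) (i, \<not> b) = x"
  using assms by (auto simp: inc_def neighbour_def)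

lemma borel_solution_edge_colouring:
  "borel_solution d (edge_coloring_problem d (2 * d)) M \<phi> (\<lambda>x. restrict (inc x) (half_edges d))"
proof -
  let ?f = "\<lambda>x. restrict (inc x) (half_edges d)"
  let ?L = "half_edges d \<rightarrow>\<^sub>E {..<2 * d}"
  have fin: "finite (half_edges d)" by (simp add: half_edges_def)
  have f_in: "?f x \<in> ?L" if "x \<in> space M" for x using inc_less[OF that] by auto
  have "?f \<in> measurable M (count_space ?L)"
  proof (subst measurable_count_space_eq2)
    show "finite ?L" by (intro finite_PiE fin) simp
    have "?f -` {l} \<inter> space M \<in> sets M" if l: "l \<in> ?L" for l
    proof -
      have "?f x = l \<longleftrightarrow> (\<forall>e\<in>half_edges d. inc x e = l e)" for x
        using l by (auto simp: fun_eq_iff PiE_iff extensional_def)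
      then have "?f -` {l} \<inter> space M = {x \<in> space M. \<forall>e\<in>half_edges d. inc x e = l e}" by auto
      moreover have "Measurable.pred M (\<lambda>x. \<forall>e\<in>half_edges d. inc x e = l e)"
      proof (rule pred_intros_finite[OF fin])
        fix e assume "e \<in> half_edges d"
        then show "Measurable.pred M (\<lambda>x. inc x e = l e)" using inc_meas by measurable
      qed
      ultimately show ?thesis by (simp add: pred_def)
    qed
    then show "?f \<in> space M \<rightarrow> ?L \<and> (\<forall>l\<in>?L. ?f -` {l} \<inter> space M \<in> sets M)" using f_in by blast
  qed
  moreover have "(\<lambda>z\<in>lattice_ball d 1. ?f (act z x)) \<in> allowed (edge_coloring_problem d (2 * d))"
    if x: "x \<in> space M" for x
  proof -
    let ?l = "\<lambda>z\<in>lattice_ball d 1. ?f (act z x)"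
    have zero: "(\<lambda>_. 0) \<in> lattice_ball d 1" by (simp add: lattice_ball_def lattice_def)
    have axis: "axis_vec i k \<in> lattice_ball d 1" if "i < d" "\<bar>k\<bar> = 1" for i k
    proof -
      have "(\<Sum>j<d. \<bar>axis_vec i k j\<bar>) = (\<Sum>j<d. if j = i then 1 else 0)"
        by (rule sum.cong) (use that in \<open>auto simp: axis_vec_def\<close>)
      then show ?thesis using that by (simp add: lattice_ball_def axis_vec_lattice)
    qed
    have l0: "?l (\<lambda>_. 0) = ?f x" using zero act_zero[of x] by (simp add: zero_fun_def)
    have l1: "?l (axis_vec i 1) = ?f (\<phi> i x)" "?l (axis_vec i (- 1)) = ?f (\<psi> i x)" if "i < d" for i
      using axis[OF that] act_axis_vec_one[OF that] by simp_all
    have "?l \<in> lattice_ball d 1 \<rightarrow>\<^sub>E ?L" using f_in act_closed[OF x] by auto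
    moreover have "inj_on (?l (\<lambda>_. 0)) (half_edges d)"
      unfolding l0 using inc_inj[OF x] by (simp add: inj_on_def)
    moreover have "?l (\<lambda>_. 0) (i, True) = ?l (axis_vec i 1) (i, False) \<and>
        ?l (\<lambda>_. 0) (i, False) = ?l (axis_vec i (- 1)) (i, True)" if i: "i < d" for i
      unfolding l0 l1[OF i] using inc_neighbour(1)[OF x, of i True] inc_neighbour(1)[OF x, of i False] i
      by (simp add: neighbour_def)
    ultimately show ?thesis unfolding edge_coloring_problem_def by simp
  qed
  ultimately show ?thesis unfolding borel_solution_def by (simp add: edge_coloring_problem_def)
qed

text \<open>The half-edge is recovered from an ordered edge by injectivity of the neighbour map. A
  colour class is a finite union, over half-edges, of graphs of generators or their inverses, cut
  down by a measurable condition on the first point.\<close>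

lemma ex_borel_edge_colouring: "\<exists>c. borel_edge_coloring M (generated_graph d M \<phi>) (2 * d) c"
proof -
  let ?E = "generated_graph d M \<phi>"
  define c where "c p = inc (fst p) (inv_into (half_edges d) (neighbour (fst p)) (snd p))" for p
  have c_nb: "c (x, neighbour x e) = inc x e" if "x \<in> space M" "e \<in> half_edges d" for x e
    using neighbour_inj[OF that(1)] that(2) by (simp add: c_def inv_into_f_f)
  have "c \<in> measurable (restrict_space (M \<Otimes>\<^sub>M M) ?E) (count_space {..<2 * d})"
  proof (subst measurable_count_space_eq2)
    let ?R = "restrict_space (M \<Otimes>\<^sub>M M) ?E"
    have c_less: "c p < 2 * d" if pR: "p \<in> space ?R" for p
    proof -
      obtain x y where p: "p = (x, y)" by (cases p)
      then obtain e where "x \<in> space M" "e \<in> half_edges d" "y = neighbour x e"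
        using pR generated_graph_iff by (auto simp: space_restrict_space)
      then show ?thesis using c_nb inc_less p by simp
    qed
    have "c -` {a} \<inter> space ?R \<in> sets ?R" for a
    proof -
      let ?S = "{p \<in> space (M \<Otimes>\<^sub>M M). \<exists>e\<in>half_edges d. snd p = neighbour (fst p) e \<and> inc (fst p) e = a}"
      have "Measurable.pred (M \<Otimes>\<^sub>M M) (\<lambda>p. \<exists>e\<in>half_edges d. snd p = neighbour (fst p) e \<and> inc (fst p) e = a)"
      proof (intro pred_intros_finite)
        show "finite (half_edges d)" by (simp add: half_edges_def)
        fix e assume e: "e \<in> half_edges d"
        then have k: "fst e < d" by (cases e) simp
        have "(\<lambda>x. neighbour x e) \<in> measurable M M"
          unfolding neighbour_def using measurable_generator[OF k] measurable_inv_generator[OF k] by simp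
        then have "Measurable.pred (M \<Otimes>\<^sub>M M) (\<lambda>p. snd p = neighbour (fst p) e)" by (rule pred_graph[OF standard])
        moreover have "Measurable.pred (M \<Otimes>\<^sub>M M) (\<lambda>p. inc (fst p) e = a)"
          using measurable_compose[OF measurable_compose[OF measurable_fst inc_meas[OF e]], of "\<lambda>n. n = a" "count_space UNIV"]
          by simp
        ultimately show "Measurable.pred (M \<Otimes>\<^sub>M M) (\<lambda>p. snd p = neighbour (fst p) e \<and> inc (fst p) e = a)"
          by (rule pred_intros_logic)
      qed
      then have "?S \<in> sets (M \<Otimes>\<^sub>M M)" by (simp add: pred_def)
      moreover have "c -` {a} \<inter> space ?R = ?E \<inter> ?S"
      proof (intro equalityI subsetI)
        fix p assume p: "p \<in> c -` {a} \<inter> space ?R"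
        obtain x y where xy: "p = (x, y)" by (cases p)
        then obtain e where "x \<in> space M" "e \<in> half_edges d" "y = neighbour x e"
          using p generated_graph_iff by (auto simp: space_restrict_space)
        then show "p \<in> ?E \<inter> ?S" using c_nb p xy by (auto simp: space_restrict_space)
      next
        fix p assume p: "p \<in> ?E \<inter> ?S"
        then obtain e where e: "e \<in> half_edges d" "snd p = neighbour (fst p) e" "inc (fst p) e = a" by blast
        have "fst p \<in> space M" using p by (auto simp: space_pair_measure)
        then have "c (fst p, snd p) = a" using c_nb e by simp
        then show "p \<in> c -` {a} \<inter> space ?R" using p by (simp add: space_restrict_space)
      qed
      ultimately show ?thesis by (auto simp: sets_restrict_space)
    qed
    then show "c \<in> space ?R \<rightarrow> {..<2 * d} \<and> (\<forall>a\<in>{..<2 * d}. c -` {a} \<inter> space ?R \<in> sets ?R)"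
      using c_less by simp
  qed simp
  moreover have "c (x, y) = c (y, x)" if "(x, y) \<in> ?E" for x y
  proof -
    obtain i b where x: "x \<in> space M" and e: "(i, b) \<in> half_edges d" "y = neighbour x (i, b)"
      using \<open>(x, y) \<in> ?E\<close> unfolding generated_graph_iff by auto
    have "c (y, neighbour y (i, \<not> b)) = inc y (i, \<not> b)"
      using e neighbour_closed[OF x e(1)] by (intro c_nb) auto
    then show ?thesis using inc_neighbour[OF x e(1)] c_nb[OF x e(1)] e(2) by simp
  qed
  moreover have "c (x, y) \<noteq> c (x, z)" if yz: "(x, y) \<in> ?E" "(x, z) \<in> ?E" "y \<noteq> z" for x y z
  proof -
    obtain e e' where x: "x \<in> space M" and e: "e \<in> half_edges d" "y = neighbour x e"
      and e': "e' \<in> half_edges d" "z = neighbour x e'"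
      using yz(1,2) unfolding generated_graph_iff by blast
    have "e \<noteq> e'" using e e' yz(3) by auto
    then show ?thesis using c_nb[OF x] e e' inj_onD[OF inc_inj[OF x]] by metis
  qed
  ultimately show ?thesis unfolding borel_edge_coloring_def by blast
qed

end

text \<open>The space has a point, and its \<open>2 * d\<close> distinct neighbours require as many
  colours at that point alone.\<close>

lemma borel_edge_colouring_lower_bound:
  assumes c: "borel_edge_coloring M (generated_graph d M \<phi>) k c"
  shows "2 * d \<le> k"
proof -
  have "space M \<noteq> {}" using free_action by (simp add: free_borel_action_def)
  then obtain x where x: "x \<in> space M" by blast
  let ?E = "generated_graph d M \<phi>"
  let ?h = "\<lambda>e. c (x, neighbour x e)"
  have E: "(x, neighbour x e) \<in> ?E" if "e \<in> half_edges d" for e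
    using that x unfolding generated_graph_iff by blast
  have "?h e \<in> {..<k}" if "e \<in> half_edges d" for e
  proof -
    have "c \<in> measurable (restrict_space (M \<Otimes>\<^sub>M M) ?E) (count_space {..<k})"
      using c by (simp add: borel_edge_coloring_def)
    moreover have "(x, neighbour x e) \<in> space (restrict_space (M \<Otimes>\<^sub>M M) ?E)"
      using E[OF that] x neighbour_closed[OF x that] by (simp add: space_restrict_space space_pair_measure)
    ultimately have "?h e \<in> space (count_space {..<k})" by (rule measurable_space)
    then show ?thesis by simp
  qed
  moreover have "inj_on ?h (half_edges d)"
  proof (rule inj_onI, rule ccontr)
    fix e e' assume e: "e \<in> half_edges d" "e' \<in> half_edges d" "?h e = ?h e'" "e \<noteq> e'"
    then have "neighbour x e \<noteq> neighbour x e'" using neighbour_inj[OF x] by (auto dest: inj_onD)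
    then show False using c E[OF e(1)] E[OF e(2)] e(3) unfolding borel_edge_coloring_def by blast
  qed
  ultimately have "card (half_edges d) \<le> card {..<k}" by (intro card_inj_on_le[of ?h]) auto
  then show ?thesis by (simp add: card_half_edges)
qed

end

theorem corollary5p6:
  fixes d :: nat
  assumes "d > 1"
  shows "in_BOREL TYPE('a) d (edge_coloring_problem d (2 * d)) \<and>
         (\<forall>(M :: 'a measure) \<phi>. free_borel_action d M \<phi> \<longrightarrow>
            borel_edge_chromatic_number M (generated_graph d M \<phi>) = enat (2 * d))"
proof -
  have key: "(\<exists>f. borel_solution d (edge_coloring_problem d (2 * d)) M \<phi> f) \<and>
      borel_edge_chromatic_number M (generated_graph d M \<phi>) = enat (2 * d)"
    if "free_borel_action d M \<phi>" for M :: "'a measure" and \<phi>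
  proof -
    interpret free_lattice_action d M \<phi> by standard (rule that)
    obtain col :: "nat \<Rightarrow> 'a \<Rightarrow> nat \<times> bool" where col:
      "\<And>k. k < d \<Longrightarrow> col k \<in> measurable M (count_space UNIV)"
      "\<And>k x. k < d \<Longrightarrow> x \<in> space M \<Longrightarrow> col k x \<in> half_edges d"
      "\<And>x. x \<in> space M \<Longrightarrow>
         inj_on (\<lambda>e. if snd e then col (fst e) x else col (fst e) (\<psi> (fst e) x)) (half_edges d)"
      using ex_half_edge_colouring[OF assms] by blast
    let ?K = "{enat k | k. \<exists>c. borel_edge_coloring M (generated_graph d M \<phi>) k c}"
    have "Inf ?K = enat (2 * d)"
    proof (rule antisym)
      show "Inf ?K \<le> enat (2 * d)"
        using ex_borel_edge_colouring[OF col] by (intro Inf_lower) auto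
      show "enat (2 * d) \<le> Inf ?K"
        using borel_edge_colouring_lower_bound by (intro Inf_greatest) auto
    qed
    then show ?thesis
      using borel_solution_edge_colouring[OF col] unfolding borel_edge_chromatic_number_def by blast
  qed
  have "finite (half_edges d \<rightarrow>\<^sub>E {..<2 * d})" by (intro finite_PiE) (simp_all add: half_edges_def)
  then have "locally_checkable d (edge_coloring_problem d (2 * d))"
    by (auto simp: locally_checkable_def edge_coloring_problem_def)
  then show ?thesis using key unfolding in_BOREL_def by blast
qed

end
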